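(* Let $\{t_n\}$ be an infinite sequence of pairwise distinct nonzero real numbers (enumerated by $n\in\mathbb{N}$ or by $n\in\mathbb{Z}$) with $|t_n|\to\infty$ as $|n|\to\infty$. The following are equivalent: (i) The spectrum $\{t_n\}$ is removable; (ii) There exists a function $F\in\mathcal{K}_1$ such that the zero set of $F$ coincides with $\{t_n\}$.
   Context: Removable spectra. Let $\{t_n\}$ be an infinite sequence of pairwise distinct nonzero real numbers with $|t_n|\to\infty$, let $\mu=\sum_n\mu_n\delta_{t_n}$ with masses $\mu_n>0$, and let $\mathcal{A}$ be the selfadjoint operator of multiplication by the independent variable $x$ in $L^2(\mu)$ with its natural domain $\mathcal{D}(\mathcal{A})=\{f\in L^2(\mu): xf\in L^2(\mu)\}$; $\mathcal{A}^{-1}$ is bounded. Let $a,b$ be functions with $a/x,\ b/x\in L^2(\mu)$ (possibly $a,b\notin L^2(\mu)$) and let $\varkappa\in\mathbb{C}$ be such that $\varkappa\neq\int_{\mathbb{R}}x^{-1}a(x)\overline{b(x)}\,d\mu(x)$ in the case when $a\in L^2(\mu)$ (no condition on $\varkappa$ if $a\notin L^2(\mu)$). The singular rank one perturbation $\mathcal{L}=\mathcal{L}(\mathcal{A},a,b,\varkappa)$ of $\mathcal{A}$ is the operator in $L^2(\mu)$ defined by $$\mathcal{D}(\mathcal{L})=\{y=y_0+c\cdot\mathcal{A}^{-1}a:\ c\in\mathbb{C},\ y_0\in\mathcal{D}(\mathcal{A}),\ \varkappa c+\langle y_0,b\rangle=0\},\qquad \mathcal{L}y=\mathcal{A}y_0,$$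 where $\mathcal{A}^{-1}a$ denotes the function $a/x$ and $\langle y_0,b\rangle=\int y_0\overline{b}\,d\mu$. (The condition on $\varkappa$ makes the decomposition of $y$ unique.) The spectrum $\{t_n\}$ is called removable if there exists a singular rank one perturbation $\mathcal{L}(\mathcal{A},a,b,\varkappa)$ of $\mathcal{A}$ whose spectrum is empty. This property does not depend on the choice of the masses $\mu_n>0$. Krein class. An entire function $F$ with $F(0)\neq0$ belongs to the Krein class $\mathcal{K}_1$ if it is real on $\mathbb{R}$, has only real simple zeros $t_n$, and may be represented as $$\frac{1}{F(z)}=q+\sum_n c_n\Big(\frac{1}{t_n-z}-\frac{1}{t_n}\Big),\qquad \sum_n t_n^{-2}|c_n|<\infty,$$ where $c_n=-1/F'(t_n)$ and $q=1/F(0)$. *)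

theory Defs
  imports "HOL-Complex_Analysis.Complex_Analysis"
begin

section \<open>The space \<open>L\<^sup>2(M)\<close> and operators in it\<close>

text \<open>Elements of \<open>L\<^sup>2(M)\<close> are represented by measurable square integrable functions;
  two of them are the same element iff they agree almost everywhere.\<close>

definition L2 :: "'a measure \<Rightarrow> ('a \<Rightarrow> complex) set" where
  "L2 M = {f \<in> borel_measurable M. integrable M (\<lambda>x. (cmod (f x))\<^sup>2)}"

definition L2_norm :: "'a measure \<Rightarrow> ('a \<Rightarrow> complex) \<Rightarrow> real" where
  "L2_norm M f = sqrt (\<integral>x. (cmod (f x))\<^sup>2 \<partial>M)"

text \<open>Also used as the pairing \<open>\<langle>f, g\<rangle>\<close> when only the product of \<open>f\<close> and \<open>cnj g\<close>
  is integrable.\<close>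

definition L2_pair :: "'a measure \<Rightarrow> ('a \<Rightarrow> complex) \<Rightarrow> ('a \<Rightarrow> complex) \<Rightarrow> complex" where
  "L2_pair M f g = (\<integral>x. f x * cnj (g x) \<partial>M)"

text \<open>An unbounded operator \<open>T\<close> in \<open>L\<^sup>2(M)\<close> is given by its graph \<open>{(y, T y). y \<in> D(T)}\<close>, closed
  under changing representatives. A number \<open>z\<close> is in the resolvent set iff \<open>T - z\<close> is a
  bijection of \<open>D(T)\<close> onto \<open>L\<^sup>2(M)\<close> with bounded inverse.\<close>

definition resolvent_set ::
  "'a measure \<Rightarrow> (('a \<Rightarrow> complex) \<times> ('a \<Rightarrow> complex)) set \<Rightarrow> complex set" where
  "resolvent_set M T = {z.
     (\<forall>(y, w) \<in> T. \<forall>(y', w') \<in> T.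
        (AE x in M. w x - z * y x = w' x - z * y' x) \<longrightarrow> (AE x in M. y x = y' x)) \<and>
     (\<forall>g \<in> L2 M. \<exists>(y, w) \<in> T. AE x in M. w x - z * y x = g x) \<and>
     (\<exists>C. \<forall>(y, w) \<in> T. L2_norm M y \<le> C * L2_norm M (\<lambda>x. w x - z * y x))}"

definition op_spectrum ::
  "'a measure \<Rightarrow> (('a \<Rightarrow> complex) \<times> ('a \<Rightarrow> complex)) set \<Rightarrow> complex set" where
  "op_spectrum M T = - resolvent_set M T"


section \<open>Singular rank one perturbations and removable spectra\<close>

text \<open>The measure \<open>\<Sum>n. m n \<cdot> \<delta>\<^bsub>t n\<^esub>\<close> on the Borel sets of the real line, as the image under \<open>t\<close>
  of the measure with point masses \<open>m n\<close> on the index type.\<close>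

definition atomic_measure :: "('i \<Rightarrow> real) \<Rightarrow> ('i \<Rightarrow> real) \<Rightarrow> real measure" where
  "atomic_measure t m = distr (density (count_space UNIV) (\<lambda>n. ennreal (m n))) borel t"

definition mult_domain :: "real measure \<Rightarrow> (real \<Rightarrow> complex) set" where
  "mult_domain M = {f \<in> L2 M. (\<lambda>x. of_real x * f x) \<in> L2 M}"

text \<open>The convention \<open>a 0 / 0 = 0\<close> is immaterial, since only measures \<open>M\<close> with
  \<open>emeasure M {0} = 0\<close> are considered.\<close>

definition div_x :: "(real \<Rightarrow> complex) \<Rightarrow> real \<Rightarrow> complex" where
  "div_x a = (\<lambda>x. a x / of_real x)"

definition perturbation_data ::
  "real measure \<Rightarrow> (real \<Rightarrow> complex) \<Rightarrow> (real \<Rightarrow> complex) \<Rightarrow> complex \<Rightarrow> bool" where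
  "perturbation_data M a b \<kappa> \<longleftrightarrow>
     div_x a \<in> L2 M \<and> div_x b \<in> L2 M \<and>
     (a \<in> L2 M \<longrightarrow> \<kappa> \<noteq> (\<integral>x. div_x a x * cnj (b x) \<partial>M))"

text \<open>The graph of \<open>\<L>(\<A>, a, b, \<kappa>)\<close>, where \<open>\<A>\<close> is the multiplication by \<open>x\<close> in \<open>L\<^sup>2(M)\<close>.
  Under \<open>perturbation_data\<close> it is single valued up to equality almost everywhere.\<close>

definition rank_one_perturbation ::
  "real measure \<Rightarrow> (real \<Rightarrow> complex) \<Rightarrow> (real \<Rightarrow> complex) \<Rightarrow> complex \<Rightarrow>
     ((real \<Rightarrow> complex) \<times> (real \<Rightarrow> complex)) set" where
  "rank_one_perturbation M a b \<kappa> =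
     {(y, w). y \<in> L2 M \<and> w \<in> L2 M \<and>
        (\<exists>c. \<exists>y0 \<in> mult_domain M.
           \<kappa> * c + L2_pair M y0 b = 0 \<and>
           (AE x in M. y x = y0 x + c * div_x a x) \<and>
           (AE x in M. w x = of_real x * y0 x))}"

definition removable_spectrum :: "('i \<Rightarrow> real) \<Rightarrow> ('i \<Rightarrow> real) \<Rightarrow> bool" where
  "removable_spectrum t m \<longleftrightarrow>
     (\<exists>a b \<kappa>. perturbation_data (atomic_measure t m) a b \<kappa> \<and>
        op_spectrum (atomic_measure t m)
          (rank_one_perturbation (atomic_measure t m) a b \<kappa>) = {})"


section \<open>The Krein class\<close>

text \<open>The series runs over the set of zeros itself rather than over an enumeration of it;
  under the summability condition it converges absolutely.\<close>

definition Krein_class_1 :: "(complex \<Rightarrow> complex) set" where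
  "Krein_class_1 = {F.
     F holomorphic_on UNIV \<and> F 0 \<noteq> 0 \<and>
     (\<forall>x::real. F (of_real x) \<in> \<real>) \<and>
     (\<forall>z. F z = 0 \<longrightarrow> z \<in> \<real> \<and> zorder F z = 1) \<and>
     (let Z = {s::real. F (of_real s) = 0};
          c = (\<lambda>s::real. - 1 / deriv F (of_real s));
          q = 1 / F 0
      in (\<lambda>s. cmod (c s) / s\<^sup>2) summable_on Z \<and>
         (\<forall>z. F z \<noteq> 0 \<longrightarrow>
            ((\<lambda>s. c s * (1 / (of_real s - z) - 1 / of_real s)) has_sum (1 / F z - q)) Z))}"

end

theory Submission
  imports Defs
begin

text \<open>
  Removability is a question about one meromorphic function. Write the perturbation in the basis of
  point masses: with \<open>\<alpha>\<^sub>n\<close>, \<open>\<beta>\<^sub>n\<close> the coordinates of \<open>a / x\<close> and of the conjugate of \<open>b / x\<close>, solving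
  \<open>(L - z) y = g\<close> leaves, for \<open>z\<close> off the points \<open>t\<^sub>n\<close>, a single scalar unknown \<open>c\<close>, and the equation
  for it is \<open>\<phi>(z) c = - \<Lambda>(g)\<close> with \<open>\<Lambda>\<close> bounded and
  \<open>\<phi>(z) = \<kappa> + \<Sum> d\<^sub>n (1 / (t\<^sub>n - z) - 1 / t\<^sub>n)\<close>, \<open>d\<^sub>n = \<alpha>\<^sub>n \<beta>\<^sub>n t\<^sub>n\<^sup>2\<close>. Hence such a \<open>z\<close> is in the spectrum iff
  \<open>\<phi>(z) = 0\<close>, while \<open>t\<^sub>k\<close> is in the spectrum iff \<open>\<alpha>\<^sub>k \<beta>\<^sub>k = 0\<close> (\<open>spectrum_empty_iff\<close>). The products \<open>d\<^sub>n\<close>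
  run through all sequences with \<open>\<Sum> |d\<^sub>n| / t\<^sub>n\<^sup>2 < \<infinity>\<close>; moreover \<open>a\<close> can always be chosen outside \<open>L\<^sup>2\<close>, which
  makes the condition on \<open>\<kappa>\<close> void (\<open>factorization_outside_l2\<close>). So the spectrum is removable iff
  some \<open>\<phi>\<close> of this form, with all \<open>d\<^sub>n\<close> nonzero, has no zeros (\<open>removable_iff_zero_free_symbol\<close>).

  A function \<open>F\<close> of the Krein class gives such a \<open>\<phi>\<close>, namely \<open>1 / F\<close>. Conversely \<open>F = 1 / \<phi>\<close> is entire
  with simple zeros exactly at the \<open>t\<^sub>n\<close>, but it need not be real on the real line, because \<open>d\<^sub>n\<close> and \<open>\<kappa>\<close> are
  complex. Let \<open>F\<^sup>*(z)\<close> be the conjugate of \<open>F\<close> at the conjugate of \<open>z\<close>. The zeros of \<open>F F\<^sup>*\<close> are all double, so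
  \<open>F F\<^sup>* = G\<^sup>2\<close> with \<open>G\<close> entire, and \<open>G\<close> is real on the real line since \<open>G\<^sup>2\<close> is nonnegative there
  (\<open>entire_real_symmetrization\<close>). The zeros of \<open>G\<close> are those of \<open>F\<close>, and \<open>|G'(t\<^sub>n)| = |F'(t\<^sub>n)|\<close>, so the
  partial fraction series \<open>S\<close> with the residues of \<open>1 / G\<close> converges. It remains to see that it represents
  \<open>1 / G\<close> (\<open>real_partial_fractions_expansion\<close>). The difference \<open>H = 1 / G - S\<close> is entire. Off the real line
  \<open>|\<phi>(z)|\<close> and \<open>|S(z)|\<close> are at most \<open>C (1 + |z|)\<^sup>2 / |Im z|\<close>, and \<open>|1 / G(z)|\<^sup>2\<close> is the product of \<open>|\<phi>|\<close> at \<open>z\<close>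
  and at its conjugate, so the same kind of bound holds for \<open>H\<close>. This forces \<open>H\<close> to be affine
  (\<open>entire_affine_if_growth_off_real_axis\<close>), and \<open>H(i y) = o(y)\<close> makes it constant.
\<close>


section \<open>Entire functions\<close>

text \<open>The three entire functions constructed below (the reciprocal of a symbol, a quotient of functions with
  the same zeros, the difference of a reciprocal and its partial fractions) are given by a formula off a
  discrete set only; a finite limit at each exceptional point is all that has to be checked.\<close>

lemma entire_extension:
  fixes f :: "complex \<Rightarrow> complex"
  assumes Z: "\<And>p. \<not> p islimpt Z"
    and hol: "f holomorphic_on - Z"
    and lim: "\<And>p. p \<in> Z \<Longrightarrow> \<exists>c. f \<midarrow>p\<rightarrow> c"
  obtains h where "h holomorphic_on UNIV" "\<And>z. z \<notin> Z \<Longrightarrow> h z = f z"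
    "\<And>p c. p \<in> Z \<Longrightarrow> f \<midarrow>p\<rightarrow> c \<Longrightarrow> h p = c"
proof
  have "closed Z"
    using Z by (simp add: closed_limpt)
  then have an: "f analytic_on {z}" if "z \<notin> Z" for z
    using hol that by (meson ComplI analytic_at open_Compl)
  show eq: "remove_sings f z = f z" if "z \<notin> Z" for z
    using an[OF that] by simp
  show "remove_sings f p = c" if "p \<in> Z" "f \<midarrow>p\<rightarrow> c" for p c
    using that by blast
  have "remove_sings f analytic_on {z}" for z
  proof (cases "z \<in> Z")
    case True
    have "closed (Z - {z})"
      using Z by (metis Diff_subset closed_limpt islimpt_subset)
    moreover have "f analytic_on - (Z - {z}) - {z}"
      by (subst analytic_on_analytic_at) (use an in auto)
    ultimately have "isolated_singularity_at f z"
      by (subst isolated_singularity_at_iff_analytic_nhd)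
         (intro exI[of _ "- (Z - {z})"] conjI open_Compl, auto)
    then show ?thesis
      using lim[OF True] remove_sings_analytic_at by blast
  next
    case False
    then show ?thesis using an remove_sings_analytic_on by blast
  qed
  then show "remove_sings f holomorphic_on UNIV"
    by (meson analytic_imp_holomorphic analytic_on_analytic_at)
qed

text \<open>The bound says nothing on the real axis. On the circle of radius \<open>R\<close> the factor \<open>z\<^sup>2 - R\<^sup>2\<close> has modulus
  \<open>2 R |Im z|\<close>, so multiplying by it absorbs the singularity of the bound; the maximum principle carries
  the estimate into the disc, and at radius \<open>R / 2\<close> the factor is comparable to \<open>R\<^sup>2\<close> and can be divided
  out again. This gives linear growth, and Liouville's theorem applies.\<close>

lemma entire_affine_if_growth_off_real_axis:
  fixes f :: "complex \<Rightarrow> complex"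
  assumes hol: "f holomorphic_on UNIV"
    and bound: "\<And>z. Im z \<noteq> 0 \<Longrightarrow> cmod (f z) * \<bar>Im z\<bar> \<le> C * (1 + cmod z) ^ 2"
  shows "f z = f 0 + deriv f 0 * z"
proof -
  have C0: "C \<ge> 0"
  proof -
    have "0 \<le> C * (1 + cmod \<i>) ^ 2"
      by (rule order_trans[OF _ bound]) auto
    then show ?thesis by (simp add: zero_le_mult_iff)
  qed
  have b': "cmod (f w) * \<bar>Im w\<bar> \<le> C * (1 + cmod w) ^ 2" for w
    using bound[of w] C0 by (cases "Im w = 0") auto
  have growth: "cmod (f w) \<le> 12 * C * cmod w ^ 1" if w: "1 \<le> cmod w" for w
  proof -
    define R where "R = 2 * cmod w"
    have R: "R \<ge> 2" using w by (simp add: R_def)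
    let ?g = "\<lambda>u. f u * (u\<^sup>2 - of_real (R\<^sup>2))"
    have "cmod (?g w) \<le> C * (1 + R) ^ 2 * (2 * R)"
    proof (rule maximum_modulus_frontier[of ?g "cball 0 R"])
      fix u assume "u \<in> frontier (cball (0::complex) R)"
      then have u: "cmod u = R" using R by (simp add: frontier_cball)
      then have "of_real (R\<^sup>2) = u * cnj u"
        by (metis complex_norm_square of_real_power)
      then have "u\<^sup>2 - of_real (R\<^sup>2) = u * (u - cnj u)"
        by (simp add: power2_eq_square right_diff_distrib)
      then have "cmod (u\<^sup>2 - of_real (R\<^sup>2)) = R * (2 * \<bar>Im u\<bar>)"
        by (simp add: norm_mult complex_diff_cnj u)
      then have "cmod (?g u) = (cmod (f u) * \<bar>Im u\<bar>) * (2 * R)"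
        by (simp add: norm_mult)
      also have "\<dots> \<le> C * (1 + R) ^ 2 * (2 * R)"
        using b'[of u] u R by (intro mult_right_mono) auto
      finally show "cmod (?g u) \<le> C * (1 + R) ^ 2 * (2 * R)" .
    next
      show "?g holomorphic_on interior (cball 0 R)"
        by (intro holomorphic_intros holomorphic_on_subset[OF hol]) auto
      show "continuous_on (closure (cball 0 R)) ?g"
        by (intro continuous_intros holomorphic_on_imp_continuous_on holomorphic_on_subset[OF hol]) auto
    qed (use R R_def in auto)
    moreover have "3 * (cmod w)\<^sup>2 \<le> cmod (w\<^sup>2 - of_real (R\<^sup>2))"
    proof -
      have "cmod (of_real (R\<^sup>2)) - cmod (w\<^sup>2) \<le> cmod (w\<^sup>2 - of_real (R\<^sup>2))"
        by (metis norm_minus_commute norm_triangle_ineq2)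
      moreover have "cmod (of_real (R\<^sup>2) :: complex) = 4 * (cmod w)\<^sup>2"
        by (simp add: R_def power2_eq_square norm_mult)
      ultimately show ?thesis unfolding norm_power by linarith
    qed
    ultimately have "cmod (f w) * (3 * (cmod w)\<^sup>2) \<le> C * (1 + R) ^ 2 * (2 * R)"
      by (smt (verit, best) mult_left_mono norm_ge_zero norm_mult)
    also have "\<dots> \<le> C * (3 * cmod w) ^ 2 * (2 * R)"
      using w C0 by (intro mult_right_mono mult_left_mono power_mono) (auto simp: R_def)
    also have "\<dots> = (12 * C * cmod w) * (3 * (cmod w)\<^sup>2)"
      by (simp add: R_def power2_eq_square)
    finally show ?thesis
      using w by (subst (asm) mult_le_cancel_right) auto
  qed
  show ?thesis
    using Liouville_polynomial[OF hol growth, where \<xi> = z] by simp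
qed

lemma simple_zero_deriv_nonzero:
  assumes hol: "f holomorphic_on UNIV" and "f z0 \<noteq> 0" "f p = 0" "zorder f p = 1"
  shows "deriv f p \<noteq> 0"
proof
  assume "deriv f p = 0"
  then have "(deriv ^^ k) f p = 0" if "k < 2" for k
    using that \<open>f p = 0\<close> by (cases k) auto
  then have "zorder f p \<ge> int 2"
    using assms by (intro zorder_geI[where A = UNIV and z = z0])
      (auto intro: holomorphic_on_imp_analytic_at)
  with assms show False by simp
qed

lemma zorder_simple_zero:
  assumes "f holomorphic_on UNIV" "f p = 0" "deriv f p \<noteq> 0"
  shows "zorder f p = 1"
  using assms by (intro zorder_zero_eqI[where S = UNIV]) auto

lemma simple_zero_difference_quotient:
  fixes f :: "complex \<Rightarrow> complex"
  assumes "f holomorphic_on UNIV" "f p = 0"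
  shows "(\<lambda>z. f z / (z - p)) \<midarrow>p\<rightarrow> deriv f p"
proof -
  have "(f has_field_derivative deriv f p) (at p)"
    using assms(1) by (simp add: holomorphic_derivI)
  then show ?thesis
    using assms(2) by (simp add: has_field_derivative_iff)
qed

text \<open>The difference is the difference quotient at \<open>p\<close> of \<open>(z - p) / f z\<close>, which extends holomorphically
  across the simple zero \<open>p\<close>; the limit is its derivative.\<close>

lemma reciprocal_regular_part_converges:
  fixes f :: "complex \<Rightarrow> complex"
  assumes hol: "f holomorphic_on UNIV" and "f p = 0" and nz: "deriv f p \<noteq> 0"
  shows "\<exists>c. (\<lambda>z. 1 / f z - 1 / (deriv f p * (z - p))) \<midarrow>p\<rightarrow> c"
proof -
  define g where "g = (\<lambda>z. if z = p then deriv f p else (f z - f p) / (z - p))"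
  have "g holomorphic_on UNIV"
    unfolding g_def by (rule pole_lemma_open[OF hol]) simp
  then have "(g has_field_derivative deriv g p) (at p)"
    by (simp add: holomorphic_derivI)
  moreover have gp: "g p = deriv f p" by (simp add: g_def)
  ultimately have "\<exists>D. ((\<lambda>z. 1 / g z) has_field_derivative D) (at p)"
    using nz by (intro exI) (rule derivative_eq_intros | simp)+
  then obtain D where "(\<lambda>z. (1 / g z - 1 / g p) / (z - p)) \<midarrow>p\<rightarrow> D"
    unfolding has_field_derivative_iff by blast
  moreover have "\<forall>\<^sub>F z in at p. (1 / g z - 1 / g p) / (z - p) = 1 / f z - 1 / (deriv f p * (z - p))"
    using eventually_neq_at_within[of p p UNIV]
  proof eventually_elim
    case (elim z)
    then have "1 / g z / (z - p) = 1 / f z"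
      using assms(2) by (simp add: g_def)
    then show ?case
      unfolding gp diff_divide_distrib by simp
  qed
  ultimately have "(\<lambda>z. 1 / f z - 1 / (deriv f p * (z - p))) \<midarrow>p\<rightarrow> D"
    by (rule Lim_transform_eventually)
  then show ?thesis ..
qed

text \<open>\<open>g / f\<close> extends to an entire function without zeros, and such a function has an entire square root.\<close>

lemma same_simple_zeros_square_quotient:
  fixes f g :: "complex \<Rightarrow> complex"
  assumes hf: "f holomorphic_on UNIV" and hg: "g holomorphic_on UNIV"
    and disc: "\<And>p. \<not> p islimpt {z. f z = 0}"
    and zeros: "\<And>z. g z = 0 \<longleftrightarrow> f z = 0"
    and simple: "\<And>z. f z = 0 \<Longrightarrow> deriv f z \<noteq> 0 \<and> deriv g z \<noteq> 0"
  obtains s where "s holomorphic_on UNIV" "\<And>z. s z \<noteq> 0" "\<And>z. g z = f z * (s z)\<^sup>2"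
proof -
  let ?Z = "{z. f z = 0}"
  have lim: "(\<lambda>z. g z / f z) \<midarrow>p\<rightarrow> deriv g p / deriv f p" if "p \<in> ?Z" for p
  proof -
    have "(\<lambda>z. (g z / (z - p)) / (f z / (z - p))) \<midarrow>p\<rightarrow> deriv g p / deriv f p"
      using that zeros simple
      by (intro tendsto_divide simple_zero_difference_quotient hf hg) auto
    then show ?thesis
      by (rule Lim_transform_eventually) (auto simp: eventually_at_filter)
  qed
  obtain q where q: "q holomorphic_on UNIV" "\<And>z. z \<notin> ?Z \<Longrightarrow> q z = g z / f z"
    "\<And>p c. p \<in> ?Z \<Longrightarrow> (\<lambda>z. g z / f z) \<midarrow>p\<rightarrow> c \<Longrightarrow> q p = c"
  proof (rule entire_extension[of ?Z "\<lambda>z. g z / f z"])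
    show "(\<lambda>z. g z / f z) holomorphic_on - ?Z"
      by (intro holomorphic_intros holomorphic_on_subset[OF hf] holomorphic_on_subset[OF hg]) auto
  qed (use disc lim in auto)
  have qnz: "q z \<noteq> 0" for z
  proof (cases "z \<in> ?Z")
    case True
    then show ?thesis using q(3)[OF True lim[OF True]] simple by auto
  next
    case False
    then show ?thesis using q(2)[OF False] zeros by auto
  qed
  obtain s where s: "s holomorphic_on UNIV" "\<And>z. z \<in> UNIV \<Longrightarrow> q z = s z ^ 2"
    by (rule contractible_imp_holomorphic_sqrt[OF q(1) contractible_UNIV qnz])
      (rule that; simp)
  show ?thesis
  proof (rule that[OF s(1)])
    show "s z \<noteq> 0" for z using qnz[of z] s(2)[of z] by auto
    show "g z = f z * (s z)\<^sup>2" for z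
      using q(2)[of z] zeros[of z] s(2)[of z] by (cases "f z = 0") auto
  qed
qed

text \<open>Although the conjugate reflection \<open>f\<^sup>*\<close> of \<open>f\<close> may differ from \<open>f\<close>, it has the same real simple zeros,
  so \<open>f\<^sup>* = f s\<^sup>2\<close> and \<open>g = f s\<close> is a square root of \<open>f f\<^sup>*\<close>. On the real line \<open>g\<^sup>2 = |f|\<^sup>2 \<ge> 0\<close>, hence \<open>g\<close> is
  real there. At a zero, comparing derivatives in \<open>f\<^sup>* = f s\<^sup>2\<close> shows \<open>|s| = 1\<close>.\<close>

lemma entire_real_symmetrization:
  fixes f :: "complex \<Rightarrow> complex"
  assumes hf: "f holomorphic_on UNIV"
    and disc: "\<And>p. \<not> p islimpt {z. f z = 0}"
    and zeros: "\<And>z. f z = 0 \<Longrightarrow> z \<in> \<real> \<and> deriv f z \<noteq> 0"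
  obtains g where "g holomorphic_on UNIV" "\<And>z. g z = 0 \<longleftrightarrow> f z = 0"
    "\<And>z. (g z)\<^sup>2 = f z * cnj (f (cnj z))"
    "\<And>x::real. g (of_real x) \<in> \<real>"
    "\<And>z. f z = 0 \<Longrightarrow> cmod (deriv g z) = cmod (deriv f z)"
proof -
  define f' where "f' = cnj \<circ> f \<circ> cnj"
  have df: "(f has_field_derivative deriv f z) (at z)" for z
    using hf by (simp add: holomorphic_derivI)
  have df': "(f' has_field_derivative cnj (deriv f (cnj z))) (at z)" for z
    unfolding f'_def using df[of "cnj z"] by (rule has_field_derivative_cnj_cnj)
  then have hf': "f' holomorphic_on UNIV"
    by (meson UNIV_I field_differentiable_at_within field_differentiable_def holomorphic_on_def)
  have zero_cnj: "f (cnj z) = 0 \<longleftrightarrow> f z = 0" for z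
    using zeros by (metis Reals_cnj_iff complex_cnj_cnj)
  have real_zero: "cnj z = z" if "f z = 0" for z
    using zeros[OF that] by (simp add: Reals_cnj_iff)
  have simple: "deriv f z \<noteq> 0 \<and> deriv f' z \<noteq> 0" if "f z = 0" for z
    using zeros[OF that] DERIV_imp_deriv[OF df'[of z]] real_zero[OF that] by auto
  have z': "f' z = 0 \<longleftrightarrow> f z = 0" for z by (simp add: f'_def zero_cnj)
  obtain s where s: "s holomorphic_on UNIV" "\<And>z. s z \<noteq> 0" "\<And>z. f' z = f z * (s z)\<^sup>2"
    using same_simple_zeros_square_quotient[OF hf hf' disc z' simple] by blast
  define g where "g = (\<lambda>z. f z * s z)"
  have ds: "(s has_field_derivative deriv s z) (at z)" for z
    using s(1) by (simp add: holomorphic_derivI)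
  have sq: "(g z)\<^sup>2 = f z * cnj (f (cnj z))" for z
    using s(3)[of z] by (simp add: g_def f'_def power2_eq_square)
  show ?thesis
  proof
    show "g holomorphic_on UNIV" unfolding g_def by (intro holomorphic_on_mult hf s(1))
    show "g z = 0 \<longleftrightarrow> f z = 0" for z using s(2) by (simp add: g_def)
    show "(g z)\<^sup>2 = f z * cnj (f (cnj z))" for z by (rule sq)
    show "g (of_real x) \<in> \<real>" for x
    proof -
      have "(g (of_real x))\<^sup>2 = of_real ((cmod (f (of_real x)))\<^sup>2)"
        using sq[of "of_real x"] by (simp add: complex_norm_square del: of_real_power)
      then have "g (of_real x) = of_real (cmod (f (of_real x)))
          \<or> g (of_real x) = - of_real (cmod (f (of_real x)))"
        by (simp add: power2_eq_iff)
      then show ?thesis by auto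
    qed
    show "cmod (deriv g z) = cmod (deriv f z)" if "f z = 0" for z
    proof -
      have "((\<lambda>z. f z * (s z)\<^sup>2) has_field_derivative deriv f z * (s z)\<^sup>2) (at z)"
        by (rule derivative_eq_intros df ds refl)+ (simp add: that)
      moreover have "(\<lambda>z. f z * (s z)\<^sup>2) = f'" using s(3) by auto
      ultimately have "cnj (deriv f z) = deriv f z * (s z)\<^sup>2"
        using DERIV_unique[OF df'[of z]] real_zero[OF that] by simp
      then have "cmod (deriv f z) = cmod (deriv f z) * (cmod (s z))\<^sup>2"
        by (metis complex_mod_cnj norm_mult norm_power)
      then have "(cmod (s z))\<^sup>2 = 1" using zeros[OF that] by simp
      then have "cmod (s z) = 1" by (simp add: power2_eq_1_iff) (smt (verit) norm_ge_zero)
      moreover have "(g has_field_derivative deriv f z * s z) (at z)"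
        unfolding g_def by (rule derivative_eq_intros df ds refl)+ (simp add: that)
      ultimately show ?thesis
        by (simp add: DERIV_imp_deriv norm_mult)
    qed
  qed
qed

section \<open>Partial fractions over a point spectrum\<close>

locale point_spectrum =
  fixes t :: "'i \<Rightarrow> real"
  assumes infinite_index: "infinite (UNIV :: 'i set)"
    and inj: "inj t"
    and nonzero [simp]: "t n \<noteq> 0"
    and tends_to_infinity: "filterlim (\<lambda>n. \<bar>t n\<bar>) at_top cofinite"
begin

lemma finite_bounded_part: "finite {n. \<not> R \<le> \<bar>t n\<bar>}"
  using tends_to_infinity unfolding filterlim_at_top eventually_cofinite by blast

lemma point_spectrum_discrete: "\<not> p islimpt (of_real ` t ` A :: complex set)"
proof
  assume "p islimpt (of_real ` t ` A)"
  then have "infinite (of_real ` t ` A \<inter> ball p 1)"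
    unfolding islimpt_eq_infinite_ball by auto
  moreover have "of_real ` t ` A \<inter> ball p 1
      \<subseteq> (of_real ` t ` {n. \<not> cmod p + 1 \<le> \<bar>t n\<bar>} :: complex set)"
  proof
    fix u assume "u \<in> of_real ` t ` A \<inter> ball p 1"
    then obtain n where n: "u = of_real (t n)" "cmod (p - of_real (t n)) < 1"
      by (auto simp: dist_norm)
    have "\<bar>t n\<bar> < cmod p + 1"
      using norm_triangle_ineq2[of "of_real (t n)" p] n(2) by (simp add: norm_minus_commute)
    with n(1) show "u \<in> of_real ` t ` {n. \<not> cmod p + 1 \<le> \<bar>t n\<bar>}" by auto
  qed
  moreover have "finite (of_real ` t ` {n. \<not> cmod p + 1 \<le> \<bar>t n\<bar>} :: complex set)"
    by (intro finite_imageI finite_bounded_part)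
  ultimately show False
    using finite_subset by blast
qed

lemma open_Compl_point_spectrum: "open (- (of_real ` t ` A) :: complex set)"
  by (metis closed_limpt open_Compl point_spectrum_discrete)

text \<open>The multipliers \<open>t\<^sub>n / (t\<^sub>n - z)\<close> and \<open>1 / (t\<^sub>n - z)\<close> of the resolvent are bounded in \<open>n\<close>, also when
  \<open>z\<close> is one of the \<open>t\<^sub>n\<close> and that index is left out.\<close>

lemma ratio_bounded:
  "\<exists>K>0. \<forall>n. of_real (t n) \<noteq> z \<longrightarrow> \<bar>t n\<bar> + 1 \<le> K * cmod (of_real (t n) - z)"
proof -
  let ?F = "{n. \<not> 2 * cmod z + 1 \<le> \<bar>t n\<bar>}"
  define K where "K = 2 + (\<Sum>n\<in>?F. (\<bar>t n\<bar> + 1) / cmod (of_real (t n) - z))"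
  have K: "K \<ge> 2" unfolding K_def by (simp add: sum_nonneg)
  moreover have "\<bar>t n\<bar> + 1 \<le> K * cmod (of_real (t n) - z)" if n: "of_real (t n) \<noteq> z" for n
  proof (cases "n \<in> ?F")
    case True
    then have "(\<bar>t n\<bar> + 1) / cmod (of_real (t n) - z)
        \<le> (\<Sum>n\<in>?F. (\<bar>t n\<bar> + 1) / cmod (of_real (t n) - z))"
      by (intro member_le_sum finite_bounded_part) auto
    then have "(\<bar>t n\<bar> + 1) / cmod (of_real (t n) - z) \<le> K" by (simp add: K_def)
    then show ?thesis using n by (simp add: field_simps)
  next
    case False
    have "\<bar>t n\<bar> - cmod z \<le> cmod (of_real (t n) - z)"
      by (metis norm_of_real norm_triangle_ineq2 real_norm_def)
    with False have "\<bar>t n\<bar> + 1 \<le> 2 * cmod (of_real (t n) - z)" by simp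
    also have "\<dots> \<le> K * cmod (of_real (t n) - z)" using K by (intro mult_right_mono) auto
    finally show ?thesis .
  qed
  ultimately show ?thesis by (intro exI[of _ K]) auto
qed

text \<open>At \<open>z = t\<^sub>n\<close> division by zero leaves the finite value \<open>- d n / t n\<close>; identities between partial
  fraction series therefore hold at the poles as well.\<close>

definition summand :: "('i \<Rightarrow> complex) \<Rightarrow> complex \<Rightarrow> 'i \<Rightarrow> complex" where
  "summand d z n = d n * (1 / (of_real (t n) - z) - 1 / of_real (t n))"

definition partial_fractions :: "('i \<Rightarrow> complex) \<Rightarrow> complex \<Rightarrow> complex" where
  "partial_fractions d z = (\<Sum>\<^sub>\<infinity>n. summand d z n)"

definition admissible :: "('i \<Rightarrow> complex) \<Rightarrow> bool" where
  "admissible d \<longleftrightarrow> (\<lambda>n. cmod (d n) / (t n)\<^sup>2) summable_on UNIV"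

definition total_weight :: "('i \<Rightarrow> complex) \<Rightarrow> real" where
  "total_weight d = (\<Sum>\<^sub>\<infinity>n. cmod (d n) / (t n)\<^sup>2)"

lemma norm_summand_le:
  assumes "\<bar>t n\<bar> \<le> K * cmod (of_real (t n) - z)"
  shows "cmod (summand d z n) \<le> cmod z * K * (cmod (d n) / (t n)\<^sup>2)"
proof -
  have ne: "of_real (t n) - z \<noteq> 0"
    using assms nonzero[of n] by auto
  have "summand d z n = d n * z / (of_real (t n) * (of_real (t n) - z))"
    using ne by (simp add: summand_def field_simps)
  then have "cmod (summand d z n) = cmod (d n) * cmod z / (\<bar>t n\<bar> * cmod (of_real (t n) - z))"
    by (simp add: norm_mult norm_divide)
  also have "\<dots> = cmod z * (\<bar>t n\<bar> / cmod (of_real (t n) - z)) * (cmod (d n) / (t n)\<^sup>2)"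
    using ne by (simp add: field_simps power2_eq_square)
  also have "\<dots> \<le> cmod z * K * (cmod (d n) / (t n)\<^sup>2)"
    using assms ne by (intro mult_right_mono mult_left_mono) (auto simp: field_simps)
  finally show ?thesis .
qed

lemma norm_summand_le_far:
  assumes "cmod z \<le> R" "2 * R \<le> \<bar>t n\<bar>"
  shows "cmod (summand d z n) \<le> R * 2 * (cmod (d n) / (t n)\<^sup>2)"
proof -
  have "\<bar>t n\<bar> - cmod z \<le> cmod (of_real (t n) - z)"
    by (metis norm_of_real norm_triangle_ineq2 real_norm_def)
  with assms have "cmod (summand d z n) \<le> cmod z * 2 * (cmod (d n) / (t n)\<^sup>2)"
    by (intro norm_summand_le) simp
  also have "\<dots> \<le> R * 2 * (cmod (d n) / (t n)\<^sup>2)"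
    using assms by (intro mult_right_mono) auto
  finally show ?thesis .
qed

context
  fixes d :: "'i \<Rightarrow> complex"
  assumes adm: "admissible d"
begin

lemma summable_far:
  assumes "cmod z \<le> R"
  shows "summand d z summable_on {n. 2 * R \<le> \<bar>t n\<bar>}"
proof (rule abs_summable_summable, rule summable_on_comparison_test)
  show "(\<lambda>n. R * 2 * (cmod (d n) / (t n)\<^sup>2)) summable_on {n. 2 * R \<le> \<bar>t n\<bar>}"
    using adm unfolding admissible_def
    by (intro summable_on_cmult_right) (rule summable_on_subset_banach, auto)
qed (use norm_summand_le_far assms in auto)

lemma partial_fractions_split:
  assumes "cmod z \<le> R"
  shows "summand d z summable_on UNIV"
    and "partial_fractions d z = (\<Sum>n | \<not> 2 * R \<le> \<bar>t n\<bar>. summand d z n)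
           + (\<Sum>\<^sub>\<infinity>n\<in>{n. 2 * R \<le> \<bar>t n\<bar>}. summand d z n)"
proof -
  have un: "UNIV = {n. \<not> 2 * R \<le> \<bar>t n\<bar>} \<union> {n. 2 * R \<le> \<bar>t n\<bar>}" by auto
  have fin: "summand d z summable_on {n. \<not> 2 * R \<le> \<bar>t n\<bar>}"
    using finite_bounded_part by (rule summable_on_finite)
  show "summand d z summable_on UNIV"
    unfolding un by (intro summable_on_Un_disjoint fin summable_far assms) auto
  have "partial_fractions d z = infsum (summand d z) {n. \<not> 2 * R \<le> \<bar>t n\<bar>}
      + infsum (summand d z) {n. 2 * R \<le> \<bar>t n\<bar>}"
    unfolding partial_fractions_def
    by (subst un, subst infsum_Un_disjoint) (auto intro: fin summable_far assms)
  then show "partial_fractions d z = (\<Sum>n | \<not> 2 * R \<le> \<bar>t n\<bar>. summand d z n)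
           + (\<Sum>\<^sub>\<infinity>n\<in>{n. 2 * R \<le> \<bar>t n\<bar>}. summand d z n)"
    using finite_bounded_part by simp
qed

lemmas summable_summand = partial_fractions_split(1)[OF order_refl]

text \<open>On a disc of radius \<open>R\<close> only finitely many terms have \<open>|t\<^sub>n| < 2 R\<close>, and the others are dominated
  uniformly. Indices with \<open>d n = 0\<close> contribute no pole, which is what makes the function holomorphic at
  \<open>t\<^sub>k\<close> after the \<open>k\<close>-th coefficient has been set to zero.\<close>

lemma partial_fractions_holomorphic:
  "partial_fractions d holomorphic_on - (of_real ` t ` {n. d n \<noteq> 0})"
proof -
  let ?Z = "of_real ` t ` {n. d n \<noteq> 0} :: complex set"
  have "partial_fractions d analytic_on {z}" if "z \<notin> ?Z" for z
  proof -
    define R where "R = cmod z + 1"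
    let ?X = "{n. 2 * R \<le> \<bar>t n\<bar>}"
    have hol: "(\<lambda>z. summand d z n) holomorphic_on A"
      if "of_real (t n) \<notin> A \<or> d n = 0" for n A
    proof (cases "d n = 0")
      case False
      with that show ?thesis
        unfolding summand_def by (intro holomorphic_intros) auto
    qed (simp add: summand_def)
    have far: "of_real (t n) \<notin> cball (0::complex) R" if "n \<in> ?X" for n
      using that nonzero[of n] by (auto simp: R_def; smt (verit) norm_ge_zero)
    have ulim: "uniform_limit (cball 0 R) (\<lambda>X z. \<Sum>n\<in>X. summand d z n)
        (\<lambda>z. \<Sum>\<^sub>\<infinity>n\<in>?X. summand d z n) (finite_subsets_at_top ?X)"
    proof (rule Weierstrass_m_test_general)
      show "(\<lambda>n. R * 2 * (cmod (d n) / (t n)\<^sup>2)) summable_on ?X"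
        using adm unfolding admissible_def
        by (intro summable_on_cmult_right) (rule summable_on_subset_banach, auto)
    qed (use norm_summand_le_far in auto)
    have hol_sums: "\<forall>\<^sub>F X in finite_subsets_at_top ?X.
        continuous_on (cball 0 R) (\<lambda>z. \<Sum>n\<in>X. summand d z n) \<and>
        (\<lambda>z. \<Sum>n\<in>X. summand d z n) holomorphic_on ball 0 R"
    proof (rule eventually_finite_subsets_at_top_weakI)
      fix X assume "finite X" "X \<subseteq> ?X"
      then have "(\<lambda>z. \<Sum>n\<in>X. summand d z n) holomorphic_on cball 0 R"
        using far by (intro holomorphic_on_sum hol) auto
      then show "continuous_on (cball 0 R) (\<lambda>z. \<Sum>n\<in>X. summand d z n) \<and>
        (\<lambda>z. \<Sum>n\<in>X. summand d z n) holomorphic_on ball 0 R"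
        by (meson ball_subset_cball holomorphic_on_imp_continuous_on holomorphic_on_subset)
    qed
    have tail: "(\<lambda>z. \<Sum>\<^sub>\<infinity>n\<in>?X. summand d z n) holomorphic_on ball 0 R"
      by (rule holomorphic_uniform_limit[OF hol_sums ulim finite_subsets_at_top_neq_bot])
    have "(\<lambda>z. (\<Sum>n | \<not> 2 * R \<le> \<bar>t n\<bar>. summand d z n) + (\<Sum>\<^sub>\<infinity>n\<in>?X. summand d z n))
        holomorphic_on ball 0 R \<inter> - ?Z"
      by (intro holomorphic_on_add holomorphic_on_sum hol holomorphic_on_subset[OF tail]) auto
    then have "partial_fractions d holomorphic_on ball 0 R \<inter> - ?Z"
      by (rule holomorphic_transform) (simp add: partial_fractions_split(2)[where R = R])
    moreover have "open (ball 0 R \<inter> - ?Z)"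
      by (intro open_Int open_ball open_Compl_point_spectrum)
    moreover have "z \<in> ball 0 R \<inter> - ?Z" using that by (simp add: R_def)
    ultimately show ?thesis using analytic_at by blast
  qed
  then have "partial_fractions d analytic_on - ?Z"
    by (subst analytic_on_analytic_at) auto
  then show ?thesis
    by (rule analytic_imp_holomorphic)
qed

lemma admissible_remove: "admissible (d(k := 0))"
  using adm unfolding admissible_def
  by (rule summable_on_comparison_test) auto

text \<open>Follows from \<open>|t\<^sub>n| \<le> 2 |z| |t\<^sub>n - z| / |Im z|\<close>, uniformly in \<open>n\<close>.\<close>

lemma partial_fractions_bound_off_real_axis:
  assumes "Im z \<noteq> 0"
  shows "cmod (partial_fractions d z) * \<bar>Im z\<bar> \<le> 2 * total_weight d * (cmod z)\<^sup>2"
proof -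
  let ?K = "2 * cmod z / \<bar>Im z\<bar>"
  have K: "\<bar>t n\<bar> \<le> ?K * cmod (of_real (t n) - z)" for n
  proof -
    have "\<bar>Im z\<bar> \<le> cmod (of_real (t n) - z)"
      using abs_Im_le_cmod[of "of_real (t n) - z"] by simp
    moreover have "\<bar>Im z\<bar> \<le> cmod z" by (rule abs_Im_le_cmod)
    moreover have "\<bar>t n\<bar> \<le> cmod z + cmod (of_real (t n) - z)"
      by (metis add.commute norm_of_real norm_triangle_sub real_norm_def)
    moreover have "cmod z * \<bar>Im z\<bar> \<le> cmod z * cmod (of_real (t n) - z)"
      using calculation by (intro mult_left_mono) auto
    moreover have "cmod (of_real (t n) - z) * \<bar>Im z\<bar> \<le> cmod (of_real (t n) - z) * cmod z"
      using calculation by (intro mult_left_mono) auto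
    moreover have "\<bar>t n\<bar> * \<bar>Im z\<bar> \<le> (cmod z + cmod (of_real (t n) - z)) * \<bar>Im z\<bar>"
      using calculation by (intro mult_right_mono) auto
    ultimately have "\<bar>t n\<bar> * \<bar>Im z\<bar> \<le> 2 * cmod z * cmod (of_real (t n) - z)"
      by (simp add: algebra_simps)
    then show ?thesis using assms by (simp add: field_simps)
  qed
  have "cmod (partial_fractions d z) \<le> cmod z * ?K * total_weight d"
    unfolding partial_fractions_def total_weight_def
  proof (rule norm_infsum_le)
    show "(summand d z has_sum infsum (summand d z) UNIV) UNIV"
      using summable_summand by simp
    show "((\<lambda>n. cmod z * ?K * (cmod (d n) / (t n)\<^sup>2)) has_sum
        cmod z * ?K * (\<Sum>\<^sub>\<infinity>n. cmod (d n) / (t n)\<^sup>2)) UNIV"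
      using adm unfolding admissible_def by (intro has_sum_cmult_right) auto
  qed (rule norm_summand_le[OF K])
  then show ?thesis using assms by (simp add: field_simps power2_eq_square)
qed

text \<open>Each summand is \<open>o(y)\<close>, and \<open>|t\<^sub>n| \<le> |t\<^sub>n - i y|\<close> gives a summable bound independent of \<open>y\<close>.\<close>

lemma partial_fractions_imaginary_axis:
  "((\<lambda>y. partial_fractions d (\<i> * of_real y) / of_real y) \<longlongrightarrow> 0) at_top"
proof -
  let ?f = "\<lambda>n y. summand d (\<i> * of_real y) n / of_real y"
  have "uniform_limit {0<..} (\<lambda>X y. \<Sum>n\<in>X. ?f n y) (\<lambda>y. \<Sum>\<^sub>\<infinity>n. ?f n y)
      (finite_subsets_at_top UNIV)"
  proof (rule Weierstrass_m_test_general)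
    show "(\<lambda>n. cmod (d n) / (t n)\<^sup>2) summable_on UNIV"
      using adm by (simp add: admissible_def)
    show "cmod (?f n y) \<le> cmod (d n) / (t n)\<^sup>2" if "y \<in> {0<..}" for n y
    proof -
      have "\<bar>t n\<bar> \<le> 1 * cmod (of_real (t n) - \<i> * of_real y)"
        using abs_Re_le_cmod[of "of_real (t n) - \<i> * of_real y"] by simp
      from norm_summand_le[OF this, of d] that show ?thesis
        by (simp add: norm_divide norm_mult divide_simps mult.commute)
    qed
  qed
  moreover have "((\<lambda>y. \<Sum>n\<in>X. ?f n y) \<longlongrightarrow> 0) at_top" for X
  proof (rule tendsto_null_sum)
    fix n
    have "((\<lambda>y. d n / of_real (t n) * (\<i> / (of_real (t n) - \<i> * of_real y))) \<longlongrightarrow> 0) at_top"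
    proof (intro tendsto_mult_right_zero tendsto_divide_0[OF tendsto_const])
      have "filterlim (\<lambda>y. - (\<i> * of_real y)) at_infinity (at_top :: real filter)"
        by (rule filterlim_norm_at_top_imp_at_infinity)
          (simp add: norm_mult filterlim_abs_real filterlim_ident)
      then show "filterlim (\<lambda>y. of_real (t n) - \<i> * of_real y) at_infinity (at_top :: real filter)"
        using tendsto_add_filterlim_at_infinity[OF tendsto_const] by fastforce
    qed
    moreover have "\<forall>\<^sub>F y in at_top. d n / of_real (t n) * (\<i> / (of_real (t n) - \<i> * of_real y)) = ?f n y"
      using eventually_gt_at_top[of 0]
    proof eventually_elim
      case (elim y)
      have "of_real (t n) - \<i> * of_real y \<noteq> 0"
        using nonzero[of n] by (auto simp: complex_eq_iff)
      with elim show ?case by (simp add: summand_def field_simps)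
    qed
    ultimately show "(?f n \<longlongrightarrow> 0) at_top"
      by (rule Lim_transform_eventually)
  qed
  ultimately have "((\<lambda>y. \<Sum>\<^sub>\<infinity>n. ?f n y) \<longlongrightarrow> 0) at_top"
    by (rule_tac swap_uniform_limit'[where g = "\<lambda>_. 0" and F = "finite_subsets_at_top UNIV"
          and S = "{0<..}"])
       (auto simp: eventually_gt_at_top)
  moreover have "(\<Sum>\<^sub>\<infinity>n. ?f n y) = partial_fractions d (\<i> * of_real y) / of_real y" for y
    unfolding partial_fractions_def divide_inverse by (rule infsum_cmult_left')
  ultimately show ?thesis by simp
qed

end

lemma partial_fractions_remove:
  assumes "admissible d"
  shows "partial_fractions d z = partial_fractions (d(k := 0)) z
           + d k * (1 / (of_real (t k) - z) - 1 / of_real (t k))"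
proof -
  have *: "partial_fractions e z = summand e z k + infsum (summand e z) (- {k})"
    if "admissible e" for e
  proof -
    have "summand e z summable_on - {k}"
      using summable_summand[OF that] by (rule summable_on_subset_banach) auto
    from infsum_insert[OF this, of k] show ?thesis
      by (simp add: partial_fractions_def insert_UNIV Compl_eq_Diff_UNIV insert_absorb)
  qed
  have "infsum (summand (d(k := 0)) z) (- {k}) = infsum (summand d z) (- {k})"
    by (intro infsum_cong) (auto simp: summand_def)
  then show ?thesis
    using *[OF assms] *[OF admissible_remove[OF assms]] by (simp add: summand_def)
qed

end

section \<open>Zero-free symbols and the Krein class\<close>

context point_spectrum
begin

text \<open>Separate the \<open>k\<close>-th term; the remaining series is continuous at \<open>t\<^sub>k\<close>.\<close>

lemma partial_fractions_residue:
  assumes adm: "admissible d"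
  shows "(\<lambda>z. (\<kappa> + partial_fractions d z) * (z - of_real (t k))) \<midarrow>of_real (t k)\<rightarrow> - d k"
    and "\<exists>c. (\<lambda>z. partial_fractions d z + d k / (z - of_real (t k))) \<midarrow>of_real (t k)\<rightarrow> c"
proof -
  let ?p = "of_real (t k) :: complex"
  let ?r = "partial_fractions (d(k := 0))"
  have "?r holomorphic_on - (of_real ` t ` {n. (d(k := 0)) n \<noteq> 0})"
    by (rule partial_fractions_holomorphic[OF admissible_remove[OF adm]])
  then have "?r analytic_on {?p}"
    by (rule holomorphic_on_imp_analytic_at)
      (use inj in \<open>auto simp: open_Compl_point_spectrum inj_eq\<close>)
  then have r: "?r \<midarrow>?p\<rightarrow> ?r ?p"
    using analytic_at_imp_isCont isContD by blast
  have split: "partial_fractions d z = ?r z - d k / (z - ?p) - d k / ?p" for z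
  proof -
    have "1 / (?p - z) = - (1 / (z - ?p))"
      by (metis minus_diff_eq minus_divide_right)
    then show ?thesis
      unfolding partial_fractions_remove[OF adm, of z k] by (simp add: algebra_simps)
  qed
  have "(\<lambda>z. ?r z - d k / ?p) \<midarrow>?p\<rightarrow> ?r ?p - d k / ?p"
    by (intro tendsto_intros r)
  then show "\<exists>c. (\<lambda>z. partial_fractions d z + d k / (z - ?p)) \<midarrow>?p\<rightarrow> c"
    by (intro exI) (simp add: split)
  \<comment> \<open>Away from \<open>t\<^sub>k\<close> the product is this continuous expression.\<close>
  have "(\<lambda>z. (\<kappa> + ?r z - d k / ?p) * (z - ?p) - d k) \<midarrow>?p\<rightarrow> (\<kappa> + ?r ?p - d k / ?p) * (?p - ?p) - d k"
    by (intro tendsto_intros r)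
  moreover have "\<forall>\<^sub>F z in at ?p. (\<kappa> + ?r z - d k / ?p) * (z - ?p) - d k
      = (\<kappa> + partial_fractions d z) * (z - ?p)"
    unfolding split eventually_at_filter by (auto simp: field_simps)
  ultimately show "(\<lambda>z. (\<kappa> + partial_fractions d z) * (z - ?p)) \<midarrow>?p\<rightarrow> - d k"
    by (simp add: Lim_transform_eventually)
qed

lemma partial_fractions_0 [simp]: "partial_fractions d 0 = 0"
  by (simp add: partial_fractions_def summand_def)

text \<open>The poles of the symbol are simple and located at the \<open>t\<^sub>n\<close>, so they become simple zeros of its
  reciprocal, with derivative determined by the residue.\<close>

lemma reciprocal_entire:
  assumes adm: "admissible d" and d: "\<And>n. d n \<noteq> 0"
    and nz: "\<And>z. z \<notin> of_real ` range t \<Longrightarrow> \<kappa> + partial_fractions d z \<noteq> 0"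
  obtains f where "f holomorphic_on UNIV" "\<And>z. f z = 0 \<longleftrightarrow> z \<in> of_real ` range t"
    "\<And>z. z \<notin> of_real ` range t \<Longrightarrow> 1 / f z = \<kappa> + partial_fractions d z"
    "\<And>k. deriv f (of_real (t k)) = - 1 / d k"
proof -
  let ?Z = "of_real ` range t :: complex set"
  let ?\<phi> = "\<lambda>z. \<kappa> + partial_fractions d z"
  have lim1: "(\<lambda>z. 1 / (?\<phi> z * (z - of_real (t k)))) \<midarrow>of_real (t k)\<rightarrow> 1 / (- d k)" for k
    by (intro tendsto_divide tendsto_const partial_fractions_residue adm) (simp add: d)
  have lim: "(\<lambda>z. 1 / ?\<phi> z) \<midarrow>of_real (t k)\<rightarrow> 0" for k
  proof -
    let ?p = "of_real (t k) :: complex"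
    have "(\<lambda>z. (z - ?p) * (1 / (?\<phi> z * (z - ?p)))) \<midarrow>?p\<rightarrow> (?p - ?p) * (1 / (- d k))"
      by (intro tendsto_mult lim1 tendsto_intros)
    then have "(\<lambda>z. (z - ?p) * (1 / (?\<phi> z * (z - ?p)))) \<midarrow>?p\<rightarrow> 0" by simp
    then show ?thesis
      by (rule Lim_transform_eventually) (auto simp: eventually_at_filter)
  qed
  obtain f where f: "f holomorphic_on UNIV" "\<And>z. z \<notin> ?Z \<Longrightarrow> f z = 1 / ?\<phi> z"
    "\<And>p c. p \<in> ?Z \<Longrightarrow> (\<lambda>z. 1 / ?\<phi> z) \<midarrow>p\<rightarrow> c \<Longrightarrow> f p = c"
  proof (rule entire_extension[of ?Z "\<lambda>z. 1 / ?\<phi> z"])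
    show "(\<lambda>z. 1 / ?\<phi> z) holomorphic_on - ?Z"
      using partial_fractions_holomorphic[OF adm] d nz
      by (intro holomorphic_intros) auto
  qed (use point_spectrum_discrete lim in blast)+
  have f0: "f (of_real (t k)) = 0" for k using f(3)[OF _ lim[of k]] by auto
  show ?thesis
  proof
    show "f z = 0 \<longleftrightarrow> z \<in> ?Z" for z
      using f0 f(2)[of z] nz[of z] by (cases "z \<in> ?Z") auto
    show "1 / f z = ?\<phi> z" if "z \<notin> ?Z" for z using f(2)[OF that] by simp
    show "deriv f (of_real (t k)) = - 1 / d k" for k
    proof -
      let ?p = "of_real (t k) :: complex"
      have "open (- (?Z - {?p}))"
      proof -
        have "?Z - {?p} = of_real ` t ` (- {k})"
          using inj by (auto simp: inj_eq)
        then show ?thesis by (simp only: open_Compl_point_spectrum)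
      qed
      then have "\<forall>\<^sub>F z in at ?p. z \<in> - (?Z - {?p}) - {?p}"
        by (intro eventually_at_in_open) auto
      then have "\<forall>\<^sub>F z in at ?p. 1 / (?\<phi> z * (z - ?p)) = f z / (z - ?p)"
        by eventually_elim (use f(2) in auto)
      from Lim_transform_eventually[OF lim1 this]
      have "(\<lambda>z. f z / (z - ?p)) \<midarrow>?p\<rightarrow> 1 / (- d k)" .
      with simple_zero_difference_quotient[OF f(1) f0[of k]] show ?thesis
        using LIM_unique by fastforce
    qed
  qed (rule f(1))
qed

lemma symbol_growth:
  assumes "admissible d" "Im z \<noteq> 0"
  shows "cmod (\<kappa> + partial_fractions d z) * \<bar>Im z\<bar> \<le> (cmod \<kappa> + 2 * total_weight d) * (1 + cmod z)\<^sup>2"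
proof -
  have w: "total_weight d \<ge> 0" unfolding total_weight_def by (intro infsum_nonneg) auto
  have z: "\<bar>Im z\<bar> \<le> cmod z" by (rule abs_Im_le_cmod)
  have z2: "(cmod z)\<^sup>2 \<le> (1 + cmod z)\<^sup>2" by (intro power_mono) auto
  have "cmod z \<le> (1 + cmod z)\<^sup>2" by (simp add: power2_eq_square algebra_simps)
  with z have "cmod \<kappa> * \<bar>Im z\<bar> \<le> cmod \<kappa> * (1 + cmod z)\<^sup>2"
    by (intro mult_left_mono) auto
  moreover have "cmod (partial_fractions d z) * \<bar>Im z\<bar> \<le> 2 * total_weight d * (1 + cmod z)\<^sup>2"
    using partial_fractions_bound_off_real_axis[OF assms] mult_left_mono[OF z2, of "2 * total_weight d"] w
    by simp
  moreover have "cmod (\<kappa> + partial_fractions d z) * \<bar>Im z\<bar>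
      \<le> (cmod \<kappa> + cmod (partial_fractions d z)) * \<bar>Im z\<bar>"
    by (intro mult_right_mono norm_triangle_ineq) auto
  ultimately show ?thesis by (simp add: distrib_right)
qed

lemma symbol_imaginary_axis:
  assumes "admissible d"
  shows "((\<lambda>y. (\<kappa> + partial_fractions d (\<i> * of_real y)) / of_real y) \<longlongrightarrow> 0) at_top"
proof -
  have "((\<lambda>y. \<kappa> / of_real y) \<longlongrightarrow> 0) (at_top :: real filter)"
    by (intro tendsto_divide_0[OF tendsto_const] filterlim_norm_at_top_imp_at_infinity)
      (simp add: filterlim_abs_real filterlim_ident)
  from tendsto_add[OF this partial_fractions_imaginary_axis[OF assms]] show ?thesis
    by (simp add: add_divide_distrib)
qed

text \<open>The function \<open>h = 1 / g - S\<close>, where \<open>S\<close> is the partial fraction series with the residues of \<open>1 / g\<close>, is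
  entire. Because \<open>|1 / g(z)|\<^sup>2\<close> is the product of the moduli of the symbol \<open>1 / f\<close> at \<open>z\<close> and at its
  conjugate, \<open>1 / g\<close> inherits the growth of the symbol, which makes \<open>h\<close> affine and, by the decay
  relative to \<open>y\<close> on the imaginary axis, constant. Its value is found at \<open>0\<close>, where \<open>S\<close> vanishes.\<close>

lemma real_partial_fractions_expansion:
  assumes adm: "admissible d"
    and f: "f holomorphic_on UNIV" "\<And>z. f z = 0 \<longleftrightarrow> z \<in> of_real ` range t"
      "\<And>z. z \<notin> of_real ` range t \<Longrightarrow> 1 / f z = \<kappa> + partial_fractions d z"
    and g: "g holomorphic_on UNIV" "\<And>z. (g z)\<^sup>2 = f z * cnj (f (cnj z))"
    and e: "admissible e" "\<And>k. e k = - 1 / deriv g (of_real (t k))" "\<And>k. e k \<noteq> 0"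
    and z: "z \<notin> of_real ` range t"
  shows "1 / g z = 1 / g 0 + partial_fractions e z"
proof -
  let ?Z = "of_real ` range t :: complex set"
  have fcnj: "f (cnj z) = 0 \<longleftrightarrow> f z = 0" for z
    unfolding f(2) by (auto simp: image_iff) (metis complex_cnj_cnj complex_cnj_complex_of_real)+
  have g0: "g z = 0 \<longleftrightarrow> z \<in> ?Z" for z
  proof -
    have "(g z)\<^sup>2 = 0 \<longleftrightarrow> f z = 0" using g(2)[of z] fcnj by simp
    then show ?thesis using f(2) by simp
  qed
  have dg: "deriv g (of_real (t k)) \<noteq> 0" for k using e(2,3)[of k] by auto
  obtain h where h: "h holomorphic_on UNIV"
    "\<And>z. z \<notin> ?Z \<Longrightarrow> h z = 1 / g z - partial_fractions e z"
  proof (rule entire_extension[of ?Z "\<lambda>z. 1 / g z - partial_fractions e z"])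
    show "(\<lambda>z. 1 / g z - partial_fractions e z) holomorphic_on - ?Z"
      using partial_fractions_holomorphic[OF e(1)] e(3) g0
      by (intro holomorphic_intros holomorphic_on_subset[OF g(1)]) auto
    show "\<exists>c. (\<lambda>z. 1 / g z - partial_fractions e z) \<midarrow>p\<rightarrow> c" if "p \<in> ?Z" for p
    proof -
      from that obtain k where k: "p = of_real (t k)" by auto
      obtain c1 where c1: "(\<lambda>z. 1 / g z - 1 / (deriv g p * (z - p))) \<midarrow>p\<rightarrow> c1"
        using reciprocal_regular_part_converges[OF g(1), of p] g0[of p] dg that k by auto
      obtain c2 where c2: "(\<lambda>z. partial_fractions e z + e k / (z - p)) \<midarrow>p\<rightarrow> c2"
        using partial_fractions_residue(2)[OF e(1), of k] k by auto
      have "(\<lambda>z. (1 / g z - 1 / (deriv g p * (z - p))) - (partial_fractions e z + e k / (z - p)))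
          \<midarrow>p\<rightarrow> c1 - c2"
        by (intro tendsto_diff c1 c2)
      then show ?thesis
        by (intro exI) (simp add: e(2) k)
    qed
  qed (use point_spectrum_discrete in auto)
  have off: "z \<notin> ?Z" if "Im z \<noteq> 0" for z using that by auto
  let ?A = "cmod \<kappa> + 2 * total_weight d"
  have w: "?A \<ge> 0" unfolding total_weight_def by (intro add_nonneg_nonneg mult_nonneg_nonneg infsum_nonneg) auto
  have prod: "(cmod (1 / g z))\<^sup>2 = cmod (\<kappa> + partial_fractions d z) * cmod (\<kappa> + partial_fractions d (cnj z))"
    if "z \<notin> ?Z" for z
  proof -
    have "cnj z \<notin> ?Z" using that fcnj f(2) by blast
    then have "cmod (\<kappa> + partial_fractions d z) * cmod (\<kappa> + partial_fractions d (cnj z))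
        = cmod (1 / f z) * cmod (1 / f (cnj z))"
      using f(3) that by simp
    also have "\<dots> = 1 / cmod ((g z)\<^sup>2)" by (simp add: g(2) norm_mult norm_divide)
    finally show ?thesis by (simp add: norm_power norm_divide power_divide)
  qed
  \<comment> \<open>Squares are compared, as \<open>g\<close> is known only through \<open>g\<^sup>2\<close>.\<close>
  have gb: "cmod (1 / g z) * \<bar>Im z\<bar> \<le> ?A * (1 + cmod z)\<^sup>2" if "Im z \<noteq> 0" for z
  proof (rule power2_le_imp_le)
    have "(cmod (1 / g z) * \<bar>Im z\<bar>)\<^sup>2
        = (cmod (\<kappa> + partial_fractions d z) * \<bar>Im z\<bar>) * (cmod (\<kappa> + partial_fractions d (cnj z)) * \<bar>Im (cnj z)\<bar>)"
      using prod[OF off[OF that]] by (simp add: power_mult_distrib power2_eq_square)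
    also have "\<dots> \<le> (?A * (1 + cmod z)\<^sup>2) * (?A * (1 + cmod (cnj z))\<^sup>2)"
      using that w by (intro mult_mono symbol_growth adm) auto
    finally show "(cmod (1 / g z) * \<bar>Im z\<bar>)\<^sup>2 \<le> (?A * (1 + cmod z)\<^sup>2)\<^sup>2"
      by (simp add: power2_eq_square)
  qed (use w in auto)
  have lin: "h z = h 0 + deriv h 0 * z" for z
  proof (rule entire_affine_if_growth_off_real_axis[OF h(1)])
    fix z assume im: "Im z \<noteq> 0"
    have "cmod (h z) * \<bar>Im z\<bar> \<le> (cmod (1 / g z) + cmod (partial_fractions e z)) * \<bar>Im z\<bar>"
      unfolding h(2)[OF off[OF im]] by (intro mult_right_mono norm_triangle_ineq4) auto
    also have "\<dots> \<le> ?A * (1 + cmod z)\<^sup>2 + (cmod 0 + 2 * total_weight e) * (1 + cmod z)\<^sup>2"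
      using gb[OF im] symbol_growth[OF e(1) im, of 0] by (simp add: distrib_right)
    finally show "cmod (h z) * \<bar>Im z\<bar> \<le> (?A + 2 * total_weight e) * (1 + cmod z)\<^sup>2"
      by (simp add: distrib_right)
  qed
  let ?y = "\<lambda>y::real. \<i> * of_real y"
  have "((\<lambda>y. 1 / g (?y y) / of_real y) \<longlongrightarrow> 0) at_top"
  proof -
    let ?u = "\<lambda>y. (\<kappa> + partial_fractions d (?y y)) / of_real y"
    have "((\<lambda>y. 4 * ?A * cmod (?u y)) \<longlongrightarrow> 0) at_top"
      using tendsto_mult_right_zero[OF tendsto_norm_zero[OF symbol_imaginary_axis[OF adm, of \<kappa>]]]
      by blast
    then have "((\<lambda>y. sqrt (4 * ?A * cmod (?u y))) \<longlongrightarrow> 0) at_top"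
      using tendsto_real_sqrt by fastforce
    moreover have "\<forall>\<^sub>F y in at_top. norm (1 / g (?y y) / of_real y) \<le> sqrt (4 * ?A * cmod (?u y))"
      using eventually_ge_at_top[of 1]
    proof eventually_elim
      case (elim y)
      have im: "Im (?y y) \<noteq> 0" using elim by simp
      have "cmod (\<kappa> + partial_fractions d (cnj (?y y))) * y \<le> ?A * (1 + y)\<^sup>2"
        using symbol_growth[OF adm, of "cnj (?y y)" \<kappa>] elim by (simp add: norm_mult)
      also have "\<dots> \<le> ?A * (2 * y)\<^sup>2"
        using elim w by (intro mult_left_mono power_mono) auto
      finally have "cmod (\<kappa> + partial_fractions d (cnj (?y y))) * y \<le> (4 * ?A * y) * y"
        by (simp add: power2_eq_square algebra_simps)
      \<comment> \<open>At \<open>- i y\<close> linear growth suffices, because the other factor \<open>\<phi>(i y)\<close> is \<open>o(y)\<close>.\<close>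
      then have b: "cmod (\<kappa> + partial_fractions d (cnj (?y y))) \<le> 4 * ?A * y"
        by (rule mult_right_le_imp_le) (use elim in auto)
      have "(norm (1 / g (?y y) / of_real y))\<^sup>2 = (cmod (1 / g (?y y)))\<^sup>2 / y\<^sup>2"
        using elim by (simp add: norm_divide norm_mult power_divide power_mult_distrib)
      also have "\<dots> = cmod (?u y) * (cmod (\<kappa> + partial_fractions d (cnj (?y y))) / y)"
        using elim unfolding prod[OF off[OF im]]
        by (simp add: norm_divide power2_eq_square)
      also have "\<dots> \<le> cmod (?u y) * (4 * ?A)"
        using b elim by (intro mult_left_mono) (auto simp: divide_simps)
      finally show ?case
        by (intro real_le_rsqrt) (simp add: mult.commute)
    qed
    ultimately show ?thesis
      by (rule_tac Lim_null_comparison)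
  qed
  moreover have "((\<lambda>y. partial_fractions e (?y y) / of_real y) \<longlongrightarrow> 0) at_top"
    by (rule partial_fractions_imaginary_axis[OF e(1)])
  ultimately have "((\<lambda>y. 1 / g (?y y) / of_real y - partial_fractions e (?y y) / of_real y) \<longlongrightarrow> 0 - 0) at_top"
    by (rule tendsto_diff)
  moreover have "\<forall>\<^sub>F y in at_top. 1 / g (?y y) / of_real y - partial_fractions e (?y y) / of_real y
      = h 0 / of_real y + deriv h 0 * \<i>"
    using eventually_gt_at_top[of 0]
  proof eventually_elim
    case (elim y)
    have "1 / g (?y y) / of_real y - partial_fractions e (?y y) / of_real y = h (?y y) / of_real y"
      using h(2)[OF off[of "?y y"]] elim by (simp add: diff_divide_distrib)
    also have "\<dots> = h 0 / of_real y + deriv h 0 * \<i>"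
      using elim lin[of "?y y"] by (simp add: field_simps)
    finally show ?case .
  qed
  ultimately have "((\<lambda>y. h 0 / of_real y + deriv h 0 * \<i>) \<longlongrightarrow> 0) (at_top :: real filter)"
    by (simp add: Lim_transform_eventually)
  moreover have "((\<lambda>y. h 0 / of_real y + deriv h 0 * \<i>) \<longlongrightarrow> 0 + deriv h 0 * \<i>) (at_top :: real filter)"
    by (intro tendsto_add tendsto_const tendsto_divide_0[OF tendsto_const]
        filterlim_norm_at_top_imp_at_infinity)
      (simp add: filterlim_abs_real filterlim_ident)
  ultimately have "deriv h 0 = 0"
    using tendsto_unique[OF trivial_limit_at_top_linorder] by fastforce
  then have "h z = h 0" using lin[of z] by simp
  moreover have "0 \<notin> ?Z" by (auto simp: image_iff)
  ultimately show ?thesis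
    using h(2)[OF z] h(2)[of 0] by (simp add: diff_eq_eq)
qed

text \<open>The symbol on the right is complex in general; passing from it to a function that is real on the real
  line is the content of the direction from right to left.\<close>

theorem Krein_class_iff_zero_free_symbol:
  "(\<exists>F\<in>Krein_class_1. {z. F z = 0} = of_real ` range t) \<longleftrightarrow>
    (\<exists>d \<kappa>. admissible d \<and> (\<forall>n. d n \<noteq> 0) \<and>
       (\<forall>z. z \<notin> of_real ` range t \<longrightarrow> \<kappa> + partial_fractions d z \<noteq> 0))"
  (is "?L \<longleftrightarrow> ?R")
proof
  assume ?L
  then obtain F where F: "F \<in> Krein_class_1" and Z: "{z. F z = 0} = of_real ` range t" by blast
  define d where "d k = - 1 / deriv F (of_real (t k))" for k
  have rZ: "{s::real. F (of_real s) = 0} = range t"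
  proof -
    have "F (of_real s) = 0 \<longleftrightarrow> s \<in> range t" for s :: real
      using Z by (auto simp: set_eq_iff image_iff)
    then show ?thesis by auto
  qed
  have hol: "F holomorphic_on UNIV" and F0: "F 0 \<noteq> 0"
    and zo: "\<And>z. F z = 0 \<Longrightarrow> zorder F z = 1"
    and sm: "(\<lambda>s. cmod (- 1 / deriv F (of_real s)) / s\<^sup>2) summable_on range t"
    and hs: "\<And>z. F z \<noteq> 0 \<Longrightarrow> ((\<lambda>s. - 1 / deriv F (of_real s) * (1 / (of_real s - z) - 1 / of_real s))
           has_sum (1 / F z - 1 / F 0)) (range t)"
    using F unfolding Krein_class_1_def Let_def rZ mem_Collect_eq by blast+
  have "F (of_real (t k)) = 0" for k using Z by blast
  then have d: "d k \<noteq> 0" for k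
    using simple_zero_deriv_nonzero[OF hol F0 _ zo] by (simp add: d_def)
  moreover have "admissible d"
    using sm inj unfolding admissible_def by (subst (asm) summable_on_reindex) (auto simp: o_def d_def)
  moreover have "1 / F 0 + partial_fractions d z \<noteq> 0" if "z \<notin> of_real ` range t" for z
  proof -
    have Fz: "F z \<noteq> 0" using that Z by blast
    have "(summand d z has_sum (1 / F z - 1 / F 0)) UNIV"
      using hs[OF Fz] inj by (subst (asm) has_sum_reindex) (auto simp: o_def d_def summand_def[abs_def])
    then have "partial_fractions d z = 1 / F z - 1 / F 0"
      unfolding partial_fractions_def by (rule infsumI)
    with Fz show ?thesis by simp
  qed
  ultimately show ?R by blast
next
  assume ?R
  then obtain d \<kappa> where adm: "admissible d" and d: "\<And>n. d n \<noteq> 0"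
    and nz: "\<And>z. z \<notin> of_real ` range t \<Longrightarrow> \<kappa> + partial_fractions d z \<noteq> 0" by blast
  obtain f where f: "f holomorphic_on UNIV" "\<And>z. f z = 0 \<longleftrightarrow> z \<in> of_real ` range t"
    "\<And>z. z \<notin> of_real ` range t \<Longrightarrow> 1 / f z = \<kappa> + partial_fractions d z"
    "\<And>k. deriv f (of_real (t k)) = - 1 / d k"
    using reciprocal_entire[OF adm d nz] by blast
  have Z: "{z. f z = 0} = of_real ` t ` UNIV" using f(2) by auto
  obtain g where g: "g holomorphic_on UNIV" "\<And>z. g z = 0 \<longleftrightarrow> f z = 0"
    "\<And>z. (g z)\<^sup>2 = f z * cnj (f (cnj z))" "\<And>x::real. g (of_real x) \<in> \<real>"
    "\<And>z. f z = 0 \<Longrightarrow> cmod (deriv g z) = cmod (deriv f z)"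
  proof (rule entire_real_symmetrization[OF f(1)])
    show "\<not> p islimpt {z. f z = 0}" for p unfolding Z by (rule point_spectrum_discrete)
    show "z \<in> \<real> \<and> deriv f z \<noteq> 0" if "f z = 0" for z
      using that f(4) d unfolding f(2) by auto
  qed blast
  define e where "e k = - 1 / deriv g (of_real (t k))" for k
  have norm_e: "cmod (e k) = cmod (d k)" for k
    using g(5)[of "of_real (t k)"] f(4)[of k] d[of k] unfolding f(2)
    by (auto simp: e_def norm_divide)
  have e: "admissible e" "e k \<noteq> 0" for k
    using adm d[of k] norm_e[of k] unfolding admissible_def by (simp add: norm_e, force)
  have dg: "deriv g (of_real (t k)) \<noteq> 0" for k using e(2)[of k] by (auto simp: e_def)
  have gZ: "g z = 0 \<longleftrightarrow> z \<in> of_real ` range t" for z using g(2) f(2) by simp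
  have rZ: "{s::real. g (of_real s) = 0} = range t" unfolding gZ by auto
  have "g 0 \<noteq> 0" unfolding gZ by (auto simp: image_iff)
  moreover have "(\<lambda>s. cmod (- 1 / deriv g (of_real s)) / s\<^sup>2) summable_on range t"
    using e(1) inj unfolding admissible_def by (subst summable_on_reindex) (auto simp: o_def e_def)
  moreover have "((\<lambda>s. - 1 / deriv g (of_real s) * (1 / (of_real s - z) - 1 / of_real s))
           has_sum (1 / g z - 1 / g 0)) (range t)" if "g z \<noteq> 0" for z
  proof -
    have "1 / g z - 1 / g 0 = infsum (summand e z) UNIV"
      using real_partial_fractions_expansion[OF adm f(1-3) g(1,3) e(1) e_def e(2), of z] that
      unfolding gZ by (simp add: partial_fractions_def)
    then have "(summand e z has_sum (1 / g z - 1 / g 0)) UNIV"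
      using summable_summand[OF e(1), of z] by simp
    then show ?thesis
      using inj by (subst has_sum_reindex) (auto simp: o_def e_def summand_def[abs_def])
  qed
  moreover have "z \<in> \<real> \<and> zorder g z = 1" if "g z = 0" for z
    using that zorder_simple_zero[OF g(1) that] dg unfolding gZ by auto
  ultimately have "g \<in> Krein_class_1"
    unfolding Krein_class_1_def Let_def rZ mem_Collect_eq using g(1,4) by blast
  then show ?L using gZ by blast
qed

end

section \<open>Square summable families\<close>

definition sq_summable :: "('i \<Rightarrow> complex) \<Rightarrow> bool" where
  "sq_summable u \<longleftrightarrow> (\<lambda>n. (cmod (u n))\<^sup>2) summable_on UNIV"

definition l2_norm :: "('i \<Rightarrow> complex) \<Rightarrow> real" where
  "l2_norm u = sqrt (\<Sum>\<^sub>\<infinity>n. (cmod (u n))\<^sup>2)"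

lemma l2_norm_nonneg [simp]: "0 \<le> l2_norm u"
  unfolding l2_norm_def by (intro real_sqrt_ge_zero infsum_nonneg) auto

lemma L2_set_le_l2_norm:
  assumes "sq_summable u" "finite F"
  shows "L2_set (\<lambda>n. cmod (u n)) F \<le> l2_norm u"
  unfolding L2_set_def l2_norm_def
  by (intro real_sqrt_le_mono finite_sum_le_infsum) (use assms in \<open>auto simp: sq_summable_def\<close>)

lemma l2_boundI:
  assumes "\<And>F. finite F \<Longrightarrow> L2_set (\<lambda>n. cmod (u n)) F \<le> B"
  shows "sq_summable u" "l2_norm u \<le> B"
proof -
  have B: "0 \<le> B" using assms[of "{}"] by simp
  have *: "(\<Sum>n\<in>F. (cmod (u n))\<^sup>2) \<le> B\<^sup>2" if "finite F" for F
    using assms[OF that] unfolding L2_set_def by (simp add: sqrt_le_D)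
  show s: "sq_summable u"
    unfolding sq_summable_def
    by (rule nonneg_bdd_above_summable_on) (auto intro!: bdd_aboveI[of _ "B\<^sup>2"] *)
  show "l2_norm u \<le> B"
    unfolding l2_norm_def
    by (intro real_le_lsqrt infsum_le_finite_sums B)
      (use s * in \<open>auto simp: sq_summable_def\<close>)
qed

lemma l2_add:
  assumes "sq_summable u" "sq_summable v"
  shows "sq_summable (\<lambda>n. u n + v n)" "l2_norm (\<lambda>n. u n + v n) \<le> l2_norm u + l2_norm v"
proof -
  have "L2_set (\<lambda>n. cmod (u n + v n)) F \<le> l2_norm u + l2_norm v" if "finite F" for F
  proof -
    have "L2_set (\<lambda>n. cmod (u n + v n)) F \<le> L2_set (\<lambda>n. cmod (u n) + cmod (v n)) F"
      by (intro L2_set_mono norm_triangle_ineq) auto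
    also have "\<dots> \<le> L2_set (\<lambda>n. cmod (u n)) F + L2_set (\<lambda>n. cmod (v n)) F"
      by (rule L2_set_triangle_ineq)
    also have "\<dots> \<le> l2_norm u + l2_norm v"
      by (intro add_mono L2_set_le_l2_norm assms that)
    finally show ?thesis .
  qed
  from l2_boundI[OF this] show "sq_summable (\<lambda>n. u n + v n)"
    "l2_norm (\<lambda>n. u n + v n) \<le> l2_norm u + l2_norm v" by auto
qed

lemma l2_dominated:
  assumes "sq_summable v" "0 \<le> K" "\<And>n. cmod (u n) \<le> K * cmod (v n)"
  shows "sq_summable u" "l2_norm u \<le> K * l2_norm v"
proof -
  have "L2_set (\<lambda>n. cmod (u n)) F \<le> K * l2_norm v" if "finite F" for F
  proof -
    have "L2_set (\<lambda>n. cmod (u n)) F \<le> L2_set (\<lambda>n. K * cmod (v n)) F"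
      by (intro L2_set_mono assms) auto
    also have "\<dots> = K * L2_set (\<lambda>n. cmod (v n)) F"
      by (rule L2_set_right_distrib[symmetric, OF assms(2)])
    also have "\<dots> \<le> K * l2_norm v"
      by (intro mult_left_mono L2_set_le_l2_norm assms that)
    finally show ?thesis .
  qed
  from l2_boundI[OF this] show "sq_summable u" "l2_norm u \<le> K * l2_norm v" by auto
qed

lemma l2_scale: "sq_summable u \<Longrightarrow> sq_summable (\<lambda>n. c * u n)"
  by (rule l2_dominated(1)[where K = "cmod c"]) (auto simp: norm_mult)

lemma l2_single:
  assumes "\<And>n. n \<noteq> k \<Longrightarrow> u n = 0"
  shows "sq_summable u" "l2_norm u \<le> cmod (u k)"
proof -
  have "L2_set (\<lambda>n. cmod (u n)) F \<le> cmod (u k)" if "finite F" for F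
  proof -
    have "L2_set (\<lambda>n. cmod (u n)) F \<le> (\<Sum>n\<in>F. cmod (u n))"
      by (rule L2_set_le_sum) auto
    also have "\<dots> = (\<Sum>n\<in>F \<inter> {k}. cmod (u n))"
      by (intro sum.mono_neutral_right that) (auto simp: assms)
    also have "\<dots> \<le> cmod (u k)" by (cases "k \<in> F") auto
    finally show ?thesis .
  qed
  from l2_boundI[OF this] show "sq_summable u" "l2_norm u \<le> cmod (u k)" by auto
qed

lemma l2_zero [simp]: "sq_summable (\<lambda>_. 0)" "l2_norm (\<lambda>_. 0) = 0"
  by (simp_all add: sq_summable_def l2_norm_def)

lemma component_le_l2_norm:
  assumes "sq_summable u"
  shows "cmod (u k) \<le> l2_norm u"
  using L2_set_le_l2_norm[OF assms, of "{k}"] by simp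

lemma l2_Cauchy_Schwarz:
  assumes "sq_summable u" "sq_summable v"
  shows "(\<lambda>n. cmod (u n * v n)) summable_on UNIV"
    and "cmod (\<Sum>\<^sub>\<infinity>n. u n * v n) \<le> l2_norm u * l2_norm v"
proof -
  have *: "(\<Sum>n\<in>F. cmod (u n * v n)) \<le> l2_norm u * l2_norm v" if "finite F" for F
  proof -
    have "(\<Sum>n\<in>F. cmod (u n * v n)) \<le> L2_set (\<lambda>n. cmod (u n)) F * L2_set (\<lambda>n. cmod (v n)) F"
      using L2_set_mult_ineq[of "\<lambda>n. cmod (u n)" "\<lambda>n. cmod (v n)" F] by (simp add: norm_mult)
    also have "\<dots> \<le> l2_norm u * l2_norm v"
      by (intro mult_mono L2_set_le_l2_norm assms that) auto
    finally show ?thesis .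
  qed
  show s: "(\<lambda>n. cmod (u n * v n)) summable_on UNIV"
    by (rule nonneg_bdd_above_summable_on) (auto intro!: bdd_aboveI[of _ "l2_norm u * l2_norm v"] *)
  have "cmod (\<Sum>\<^sub>\<infinity>n. u n * v n) \<le> (\<Sum>\<^sub>\<infinity>n. cmod (u n * v n))"
    by (rule norm_infsum_bound[OF s])
  also have "\<dots> \<le> l2_norm u * l2_norm v"
    by (rule infsum_le_finite_sums[OF s *])
  finally show "cmod (\<Sum>\<^sub>\<infinity>n. u n * v n) \<le> l2_norm u * l2_norm v" .
qed

lemmas l2_product_summable = abs_summable_summable[OF l2_Cauchy_Schwarz(1)]

section \<open>The resolvent equation in coordinates\<close>

text \<open>An element of the domain is encoded by the pair of \<open>w = L y\<close> and the scalar \<open>c\<close>: then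
  \<open>y = w / t + c \<alpha>\<close>, and \<open>y\<^sub>0 = w / t\<close> is automatically in the domain of multiplication, as the \<open>t\<^sub>n\<close> are
  bounded away from zero. Here \<open>\<beta>\<close> stands for the conjugate of \<open>b / x\<close>, so that the pairing with \<open>b\<close>
  becomes the bilinear sum of \<open>w \<beta>\<close>.\<close>

locale rank_one_sequence_model = point_spectrum t
  for t :: "'i \<Rightarrow> real" +
  fixes \<alpha> \<beta> :: "'i \<Rightarrow> complex" and \<kappa> :: complex
  assumes \<alpha>: "sq_summable \<alpha>" and \<beta>: "sq_summable \<beta>"
begin

definition resolvent_equation where
  "resolvent_equation z c w g \<longleftrightarrow> \<kappa> * c + (\<Sum>\<^sub>\<infinity>n. w n * \<beta> n) = 0 \<and>
     (\<forall>n. w n - z * (w n / of_real (t n) + c * \<alpha> n) = g n)"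

text \<open>\<open>\<kappa> + partial_fractions residue_coeffs z\<close> is the symbol \<open>\<phi>\<close> of the perturbation.\<close>

definition residue_coeffs :: "'i \<Rightarrow> complex" where
  "residue_coeffs n = \<alpha> n * \<beta> n * (of_real (t n))\<^sup>2"

lemma admissible_residue_coeffs: "admissible residue_coeffs"
proof -
  have "cmod (residue_coeffs n) / (t n)\<^sup>2 = cmod (\<alpha> n * \<beta> n)" for n
    by (simp add: residue_coeffs_def norm_mult norm_power)
  then show ?thesis
    unfolding admissible_def using l2_Cauchy_Schwarz(1)[OF \<alpha> \<beta>] by simp
qed

text \<open>The value at \<open>t\<^sub>n = z\<close> is \<open>0\<close>, by division by zero; the component there is not determined by
  \<open>g\<close> and \<open>c\<close>.\<close>

definition solution_part where
  "solution_part z c g n = of_real (t n) / (of_real (t n) - z) * (g n + z * c * \<alpha> n)"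

lemma multiplier_bound:
  assumes "\<forall>n. of_real (t n) \<noteq> z \<longrightarrow> \<bar>t n\<bar> + 1 \<le> K * cmod (of_real (t n) - z)" "0 \<le> K"
  shows "cmod (of_real (t n) / (of_real (t n) - z)) \<le> K" "cmod (1 / (of_real (t n) - z)) \<le> K"
proof -
  have "of_real (t n) \<noteq> z \<Longrightarrow> \<bar>t n\<bar> / cmod (of_real (t n) - z) \<le> K
      \<and> 1 / cmod (of_real (t n) - z) \<le> K"
    using spec[OF assms(1), of n] by (auto simp: field_simps)
  then show "cmod (of_real (t n) / (of_real (t n) - z)) \<le> K" "cmod (1 / (of_real (t n) - z)) \<le> K"
    using assms(2) by (cases "of_real (t n) = z"; simp add: norm_divide)+
qed

lemma solution_part_bound:
  assumes "\<forall>n. of_real (t n) \<noteq> z \<longrightarrow> \<bar>t n\<bar> + 1 \<le> K * cmod (of_real (t n) - z)" "0 \<le> K"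
  shows "cmod (solution_part z c g n) \<le> K * cmod (g n + z * c * \<alpha> n)"
  unfolding solution_part_def norm_mult
  by (intro mult_right_mono multiplier_bound(1)[OF assms]) simp

lemma solution_part_l2:
  assumes "sq_summable g"
  shows "sq_summable (solution_part z c g)"
proof -
  obtain K where K: "K > 0" "\<forall>n. of_real (t n) \<noteq> z \<longrightarrow> \<bar>t n\<bar> + 1 \<le> K * cmod (of_real (t n) - z)"
    using ratio_bounded by blast
  show ?thesis
  proof (rule l2_dominated(1))
    show "sq_summable (\<lambda>n. g n + z * c * \<alpha> n)" by (intro l2_add l2_scale assms \<alpha>)
    show "cmod (solution_part z c g n) \<le> K * cmod (g n + z * c * \<alpha> n)" for n
      using solution_part_bound[OF K(2)] K(1) by simp
  qed (use K in simp)
qed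

text \<open>The last sum has at most one term. It cancels the value that division by zero assigns to the \<open>k\<close>-th
  summand of the series when \<open>z = t\<^sub>k\<close>.\<close>

lemma functional_of_solution_part:
  assumes "sq_summable g"
  shows "(\<Sum>\<^sub>\<infinity>n. solution_part z c g n * \<beta> n)
      = (\<Sum>\<^sub>\<infinity>n. solution_part z 0 g n * \<beta> n) + c * partial_fractions residue_coeffs z
          + c * z * (\<Sum>\<^sub>\<infinity>n. (if of_real (t n) = z then \<alpha> n * \<beta> n else 0))"
proof -
  have fin: "finite {n. of_real (t n) = z}"
  proof (rule finite_subset)
    show "{n. of_real (t n) = z} \<subseteq> {n. \<not> cmod z + 1 \<le> \<bar>t n\<bar>}" by auto
  qed (rule finite_bounded_part)
  have s1: "(\<lambda>n. solution_part z 0 g n * \<beta> n) summable_on UNIV"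
    by (intro l2_product_summable solution_part_l2 assms \<beta>)
  have s2: "(\<lambda>n. c * summand residue_coeffs z n) summable_on UNIV"
    by (intro summable_on_cmult_right summable_summand admissible_residue_coeffs)
  have s3: "(\<lambda>n. c * z * (if of_real (t n) = z then \<alpha> n * \<beta> n else 0)) summable_on UNIV"
    by (intro summable_on_cmult_right finite_nonzero_values_imp_summable_on finite_subset[OF _ fin]) auto
  have "solution_part z c g n * \<beta> n = solution_part z 0 g n * \<beta> n + c * summand residue_coeffs z n
      + c * z * (if of_real (t n) = z then \<alpha> n * \<beta> n else 0)" for n
  proof (cases "of_real (t n) = z")
    case True
    then show ?thesis
      by (auto simp: solution_part_def summand_def residue_coeffs_def power2_eq_square)
  next
    case False
    then have "summand residue_coeffs z n = of_real (t n) / (of_real (t n) - z) * (z * \<alpha> n * \<beta> n)"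
      by (simp add: summand_def residue_coeffs_def field_simps power2_eq_square)
    with False show ?thesis
      by (simp add: solution_part_def algebra_simps add_divide_distrib)
  qed
  then show ?thesis
    unfolding partial_fractions_def
    by (simp add: infsum_add s1 s2 s3 summable_on_add infsum_cmult_right')
qed

lemma resolvent_equation_componentwise:
  "w n - z * (w n / of_real (t n) + c * \<alpha> n) = g n \<longleftrightarrow>
     (if of_real (t n) = z then - z * c * \<alpha> n = g n else w n = solution_part z c g n)"
proof (cases "of_real (t n) = z")
  case True
  then have "w n - z * (w n / of_real (t n) + c * \<alpha> n) = - z * c * \<alpha> n"
    by (auto simp: distrib_left)
  with True show ?thesis by simp
next
  case False
  then show ?thesis by (auto simp: solution_part_def field_simps)
qed

text \<open>The solution \<open>y\<close> is the sum of \<open>g / (t - z)\<close>, of \<open>c \<alpha> t / (t - z)\<close> and of at most one component, at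
  an index with \<open>t\<^sub>n = z\<close>. Only the two scalars \<open>c\<close> and \<open>\<eta>\<close> remain to be controlled.\<close>

lemma resolvent_bound_from_scalars:
  assumes g: "sq_summable g" and eq: "resolvent_equation z c w g" and "0 \<le> K"
    and K: "\<forall>n. of_real (t n) \<noteq> z \<longrightarrow> \<bar>t n\<bar> + 1 \<le> K * cmod (of_real (t n) - z)"
    and \<eta>: "\<And>n. of_real (t n) = z \<Longrightarrow> cmod (w n / of_real (t n) + c * \<alpha> n) \<le> \<eta>" "0 \<le> \<eta>"
  shows "l2_norm (\<lambda>n. w n / of_real (t n) + c * \<alpha> n)
      \<le> K * l2_norm g + K * cmod c * l2_norm \<alpha> + \<eta>"
proof -
  let ?y = "\<lambda>n. w n / of_real (t n) + c * \<alpha> n"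
  let ?u = "\<lambda>n. 1 / (of_real (t n) - z) * g n"
  let ?v = "\<lambda>n. c * (of_real (t n) / (of_real (t n) - z)) * \<alpha> n"
  let ?x = "\<lambda>n. if of_real (t n) = z then ?y n else 0"
  have u: "sq_summable ?u" "l2_norm ?u \<le> K * l2_norm g"
  proof -
    have "cmod (?u n) \<le> K * cmod (g n)" for n
      unfolding norm_mult by (intro mult_right_mono multiplier_bound(2)[OF K \<open>0 \<le> K\<close>]) simp
    from l2_dominated[OF g \<open>0 \<le> K\<close> this] show "sq_summable ?u" "l2_norm ?u \<le> K * l2_norm g"
      by auto
  qed
  have v: "sq_summable ?v" "l2_norm ?v \<le> (K * cmod c) * l2_norm \<alpha>"
  proof -
    have "cmod (?v n) \<le> (K * cmod c) * cmod (\<alpha> n)" for n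
      unfolding norm_mult mult.commute[of K]
      by (intro mult_right_mono mult_left_mono multiplier_bound(1)[OF K \<open>0 \<le> K\<close>]) simp_all
    from l2_dominated[OF \<alpha> _ this] \<open>0 \<le> K\<close>
    show "sq_summable ?v" "l2_norm ?v \<le> (K * cmod c) * l2_norm \<alpha>" by auto
  qed
  have x: "sq_summable ?x \<and> l2_norm ?x \<le> \<eta>"
  proof (cases "\<exists>k. of_real (t k) = z")
    case True
    then obtain k where k: "of_real (t k) = z" by blast
    have "?x n = 0" if "n \<noteq> k" for n using that inj k by (auto simp: inj_eq)
    from l2_single[of k ?x, OF this] \<eta>(1)[OF k] k show ?thesis by auto
  next
    case False
    then have "?x = (\<lambda>_. 0)" by auto
    then show ?thesis using \<eta>(2) by auto
  qed
  have "?y n = ?u n + ?v n + ?x n" for n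
  proof (cases "of_real (t n) = z")
    case False
    then have "w n = solution_part z c g n"
      using eq resolvent_equation_componentwise[of w n z c g]
      by (auto simp: resolvent_equation_def)
    moreover have "z * c * \<alpha> n / (of_real (t n) - z) + c * \<alpha> n
        = c * (of_real (t n) / (of_real (t n) - z)) * \<alpha> n"
      using False by (simp add: field_simps)
    ultimately show ?thesis using False by (simp add: solution_part_def add_divide_distrib)
  qed auto
  then have "l2_norm ?y = l2_norm (\<lambda>n. ?u n + ?v n + ?x n)" by simp
  also have "\<dots> \<le> l2_norm (\<lambda>n. ?u n + ?v n) + l2_norm ?x"
    using x by (intro l2_add u v) auto
  also have "\<dots> \<le> l2_norm ?u + l2_norm ?v + l2_norm ?x"
    by (intro add_right_mono l2_add u v)
  finally show ?thesis using u(2) v(2) x by (simp add: mult.assoc)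
qed

text \<open>The components of the equation express \<open>w\<close> by \<open>g\<close> and \<open>c\<close>; the side condition then reads
  \<open>\<phi>(z) c = - \<Lambda>(g)\<close> with a bounded functional \<open>\<Lambda>\<close>.\<close>

lemma resolvent_off_spectrum:
  assumes z: "z \<notin> of_real ` range t" and nz: "\<kappa> + partial_fractions residue_coeffs z \<noteq> 0"
  shows "\<exists>C. \<forall>w g c. sq_summable g \<longrightarrow> resolvent_equation z c w g \<longrightarrow>
           l2_norm (\<lambda>n. w n / of_real (t n) + c * \<alpha> n) \<le> C * l2_norm g"
    and "sq_summable g \<Longrightarrow> \<exists>w c. sq_summable w \<and> resolvent_equation z c w g"
proof -
  let ?\<phi> = "\<kappa> + partial_fractions residue_coeffs z"
  let ?\<Lambda> = "\<lambda>g. \<Sum>\<^sub>\<infinity>n. solution_part z 0 g n * \<beta> n"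
  have tz: "of_real (t n) \<noteq> z" for n using z by auto
  have iff: "resolvent_equation z c w g \<longleftrightarrow> w = solution_part z c g \<and> ?\<phi> * c = - ?\<Lambda> g"
    if "sq_summable g" for c w g
  proof -
    have "resolvent_equation z c w g \<longleftrightarrow> \<kappa> * c + (\<Sum>\<^sub>\<infinity>n. w n * \<beta> n) = 0 \<and> w = solution_part z c g"
      unfolding resolvent_equation_def resolvent_equation_componentwise by (auto simp: tz)
    also have "\<dots> \<longleftrightarrow> w = solution_part z c g \<and> ?\<phi> * c = - ?\<Lambda> g"
      using functional_of_solution_part[OF that, of z c] tz
      by (auto simp: algebra_simps eq_neg_iff_add_eq_0)
    finally show ?thesis .
  qed
  show "\<exists>w c. sq_summable w \<and> resolvent_equation z c w g" if "sq_summable g" for g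
    using solution_part_l2[OF that] nz
    by (intro exI[of _ "solution_part z (- ?\<Lambda> g / ?\<phi>) g"] exI[of _ "- ?\<Lambda> g / ?\<phi>"])
      (simp add: iff[OF that])
  obtain K where K: "K > 0" "\<forall>n. of_real (t n) \<noteq> z \<longrightarrow> \<bar>t n\<bar> + 1 \<le> K * cmod (of_real (t n) - z)"
    using ratio_bounded by blast
  define C where "C = K * l2_norm \<beta> / cmod ?\<phi>"
  show "\<exists>C. \<forall>w g c. sq_summable g \<longrightarrow> resolvent_equation z c w g \<longrightarrow>
           l2_norm (\<lambda>n. w n / of_real (t n) + c * \<alpha> n) \<le> C * l2_norm g"
  proof (intro exI allI impI)
    fix w g c assume g: "sq_summable g" and eq: "resolvent_equation z c w g"
    have "l2_norm (solution_part z 0 g) \<le> K * l2_norm g"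
      using K solution_part_bound[OF K(2), of 0 g] by (intro l2_dominated(2)[OF g]) auto
    then have "l2_norm (solution_part z 0 g) * l2_norm \<beta> \<le> K * l2_norm g * l2_norm \<beta>"
      by (intro mult_right_mono) auto
    moreover have "?\<phi> * c = - ?\<Lambda> g"
      using iff[OF g, of c w] eq by blast
    then have "cmod ?\<phi> * cmod c = cmod (?\<Lambda> g)"
      by (simp only: norm_mult[symmetric] norm_minus_cancel)
    moreover have "cmod (?\<Lambda> g) \<le> l2_norm (solution_part z 0 g) * l2_norm \<beta>"
      by (intro l2_Cauchy_Schwarz solution_part_l2 g \<beta>)
    ultimately have c: "cmod c \<le> C * l2_norm g"
      using nz by (simp add: C_def field_simps)
    have "l2_norm (\<lambda>n. w n / of_real (t n) + c * \<alpha> n) \<le> K * l2_norm g + K * cmod c * l2_norm \<alpha> + 0"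
      using K by (intro resolvent_bound_from_scalars[OF g eq]) (auto simp: tz)
    also have "K * cmod c * l2_norm \<alpha> \<le> K * (C * l2_norm g) * l2_norm \<alpha>"
      using c K by (intro mult_right_mono mult_left_mono) auto
    finally show "l2_norm (\<lambda>n. w n / of_real (t n) + c * \<alpha> n) \<le> (K + K * C * l2_norm \<alpha>) * l2_norm g"
      by (simp add: algebra_simps)
  qed
qed

text \<open>At \<open>z = t\<^sub>k\<close> the \<open>k\<close>-th component of the equation contains only \<open>c\<close>, with coefficient \<open>- z \<alpha> k\<close>, and
  determines it. All components of \<open>w\<close> but the \<open>k\<close>-th follow, and the side condition, in which \<open>w k\<close> has the
  coefficient \<open>\<beta> k\<close>, determines the last one.\<close>

lemma resolvent_on_spectrum:
  assumes z: "z = of_real (t k)" and nz: "\<alpha> k \<noteq> 0" "\<beta> k \<noteq> 0"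
  shows "\<exists>C. \<forall>w g c. sq_summable g \<longrightarrow> resolvent_equation z c w g \<longrightarrow>
           l2_norm (\<lambda>n. w n / of_real (t n) + c * \<alpha> n) \<le> C * l2_norm g"
    and "sq_summable g \<Longrightarrow> \<exists>w c. sq_summable w \<and> resolvent_equation z c w g"
proof -
  have tz: "of_real (t n) = z \<longleftrightarrow> n = k" for n using z inj by (auto simp: inj_eq)
  have z0: "z \<noteq> 0" using z by simp
  let ?w = "\<lambda>c \<omega> g n. solution_part z c g n + (if n = k then \<omega> else 0)"
  let ?P = "\<lambda>c g. \<Sum>\<^sub>\<infinity>n. solution_part z c g n * \<beta> n"
  have single: "sq_summable (\<lambda>n. if n = k then \<omega> else 0)" for \<omega>
    by (rule l2_single[of k]) auto
  have wP: "(\<Sum>\<^sub>\<infinity>n. ?w c \<omega> g n * \<beta> n) = ?P c g + \<omega> * \<beta> k" if g: "sq_summable g" for c \<omega> g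
  proof -
    have "(\<Sum>\<^sub>\<infinity>n. (if n = k then \<omega> else 0) * \<beta> n) = (\<Sum>\<^sub>\<infinity>n\<in>{k}. (if n = k then \<omega> else 0) * \<beta> n)"
      by (intro infsum_cong_neutral) auto
    then show ?thesis
      unfolding distrib_right
      by (subst infsum_add) (auto intro!: l2_product_summable solution_part_l2 g \<beta> single)
  qed
  have sk: "solution_part z c g k = 0" for c g by (simp add: solution_part_def z)
  have iff: "resolvent_equation z c w g \<longleftrightarrow> c = - g k / (z * \<alpha> k) \<and> w = ?w c (w k) g
      \<and> w k * \<beta> k = - (\<kappa> * c + ?P c g)"
    if g: "sq_summable g" for c w g
  proof -
    have "(\<forall>n. w n - z * (w n / of_real (t n) + c * \<alpha> n) = g n)
        \<longleftrightarrow> c = - g k / (z * \<alpha> k) \<and> w = ?w c (w k) g"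
    proof -
      have "- z * c * \<alpha> k = g k \<longleftrightarrow> c * (z * \<alpha> k) = - g k"
        by (simp add: minus_equation_iff[of _ "g k"] eq_commute[of "- g k"] mult_ac)
      also have "\<dots> \<longleftrightarrow> c = - g k / (z * \<alpha> k)"
        by (rule nonzero_eq_divide_eq[symmetric]) (use nz z0 in simp)
      finally show ?thesis
        unfolding resolvent_equation_componentwise tz using sk[of c g]
        by (auto simp: fun_eq_iff)
    qed
    moreover have "\<kappa> * c + (\<Sum>\<^sub>\<infinity>n. w n * \<beta> n) = 0 \<longleftrightarrow> w k * \<beta> k = - (\<kappa> * c + ?P c g)"
      if "w = ?w c (w k) g"
    proof -
      have w: "w n = ?w c (w k) g n" for n using fun_cong[OF that] .
      have "(\<Sum>\<^sub>\<infinity>n. w n * \<beta> n) = (\<Sum>\<^sub>\<infinity>n. ?w c (w k) g n * \<beta> n)"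
        by (intro infsum_cong arg_cong2[where f = "(*)"] w refl)
      then show ?thesis
        unfolding wP[OF g] eq_neg_iff_add_eq_0 by (simp add: add_ac)
    qed
    ultimately show ?thesis unfolding resolvent_equation_def by blast
  qed
  show "\<exists>w c. sq_summable w \<and> resolvent_equation z c w g" if g: "sq_summable g" for g
  proof -
    define c where "c = - g k / (z * \<alpha> k)"
    define \<omega> where "\<omega> = - (\<kappa> * c + ?P c g) / \<beta> k"
    have "resolvent_equation z c (?w c \<omega> g) g"
      unfolding iff[OF g] sk
    proof (intro conjI)
      show "c = - g k / (z * \<alpha> k)" by (rule c_def)
      show "(0 + (if k = k then \<omega> else 0)) * \<beta> k = - (\<kappa> * c + ?P c g)"
        using nz by (simp add: \<omega>_def)
    qed (simp add: fun_eq_iff)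
    moreover have "sq_summable (?w c \<omega> g)"
      by (intro l2_add solution_part_l2 g single)
    ultimately show ?thesis by blast
  qed
  obtain K where K: "K > 0" "\<forall>n. of_real (t n) \<noteq> z \<longrightarrow> \<bar>t n\<bar> + 1 \<le> K * cmod (of_real (t n) - z)"
    using ratio_bounded by blast
  define C where "C = 1 / (cmod z * cmod (\<alpha> k))"
  define D where "D = (cmod \<kappa> * C + (K + K * cmod z * C * l2_norm \<alpha>) * l2_norm \<beta>) / cmod (\<beta> k)"
  show "\<exists>C. \<forall>w g c. sq_summable g \<longrightarrow> resolvent_equation z c w g \<longrightarrow>
           l2_norm (\<lambda>n. w n / of_real (t n) + c * \<alpha> n) \<le> C * l2_norm g"
  proof (intro exI allI impI)
    fix w g c assume g: "sq_summable g" and eq: "resolvent_equation z c w g"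
    let ?N = "l2_norm g"
    have C0: "C \<ge> 0" by (simp add: C_def)
    have "cmod c = C * cmod (g k)"
      using iff[OF g, of c w] eq by (simp add: C_def norm_divide norm_mult)
    then have c: "cmod c \<le> C * ?N"
      using component_le_l2_norm[OF g] C0 by (simp add: mult_left_mono)
    have "l2_norm (solution_part z c g) \<le> K * l2_norm (\<lambda>n. g n + z * c * \<alpha> n)"
      using K solution_part_bound[OF K(2), of c g]
      by (intro l2_dominated(2)[OF l2_add(1)[OF g l2_scale[OF \<alpha>]]]) auto
    also have "\<dots> \<le> K * (?N + cmod (z * c) * l2_norm \<alpha>)"
    proof (intro mult_left_mono order_trans[OF l2_add(2)] add_left_mono)
      show "l2_norm (\<lambda>n. z * c * \<alpha> n) \<le> cmod (z * c) * l2_norm \<alpha>"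
        by (rule l2_dominated[OF \<alpha>]) (auto simp: norm_mult)
    qed (use K g \<alpha> in \<open>auto intro: l2_scale\<close>)
    also have "\<dots> \<le> K * (?N + cmod z * (C * ?N) * l2_norm \<alpha>)"
      unfolding norm_mult using c K
      by (intro mult_left_mono add_left_mono mult_right_mono) auto
    also have "\<dots> = (K + K * cmod z * C * l2_norm \<alpha>) * ?N" by (simp add: algebra_simps)
    finally have s: "l2_norm (solution_part z c g) \<le> (K + K * cmod z * C * l2_norm \<alpha>) * ?N" .
    have "w k * \<beta> k = - (\<kappa> * c + ?P c g)"
      using iff[OF g, of c w] eq by blast
    then have "cmod (w k) * cmod (\<beta> k) = cmod (\<kappa> * c + ?P c g)"
      by (simp only: norm_mult[symmetric] norm_minus_cancel)
    also have "\<dots> \<le> cmod \<kappa> * cmod c + l2_norm (solution_part z c g) * l2_norm \<beta>"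
      by (intro norm_triangle_mono l2_Cauchy_Schwarz solution_part_l2 g \<beta>) (simp add: norm_mult)
    also have "\<dots> \<le> cmod \<kappa> * (C * ?N) + (K + K * cmod z * C * l2_norm \<alpha>) * ?N * l2_norm \<beta>"
      using c s by (intro add_mono mult_left_mono mult_right_mono) auto
    also have "\<dots> = D * ?N * cmod (\<beta> k)"
      using nz by (simp add: D_def algebra_simps add_divide_distrib)
    finally have wk: "cmod (w k) \<le> D * ?N" using nz by simp
    let ?\<eta> = "D * ?N / cmod z + C * ?N * cmod (\<alpha> k)"
    have "l2_norm (\<lambda>n. w n / of_real (t n) + c * \<alpha> n) \<le> K * ?N + K * cmod c * l2_norm \<alpha> + ?\<eta>"
    proof (rule resolvent_bound_from_scalars[OF g eq])
      have "cmod (w k / of_real (t k) + c * \<alpha> k) \<le> cmod (w k) / cmod z + cmod c * cmod (\<alpha> k)"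
        unfolding z by (rule norm_triangle_mono) (simp_all add: norm_divide norm_mult)
      also have "\<dots> \<le> ?\<eta>"
        using wk c by (intro add_mono divide_right_mono mult_right_mono) auto
      finally have *: "cmod (w k / of_real (t k) + c * \<alpha> k) \<le> ?\<eta>" .
      then show "cmod (w n / of_real (t n) + c * \<alpha> n) \<le> ?\<eta>" if "of_real (t n) = z" for n
        using that tz by simp
      show "0 \<le> ?\<eta>" using order_trans[OF norm_ge_zero *] .
    qed (use K in auto)
    also have "K * cmod c * l2_norm \<alpha> \<le> K * (C * ?N) * l2_norm \<alpha>"
      using c K by (intro mult_right_mono mult_left_mono) auto
    finally show "l2_norm (\<lambda>n. w n / of_real (t n) + c * \<alpha> n)
        \<le> (K + K * C * l2_norm \<alpha> + D / cmod z + C * cmod (\<alpha> k)) * ?N"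
      by (simp add: algebra_simps)
  qed
qed

text \<open>The eigenvector is \<open>a / (x - z)\<close>.\<close>

lemma zero_symbol_gives_eigenvector:
  assumes z: "z \<notin> of_real ` range t" and zero: "\<kappa> + partial_fractions residue_coeffs z = 0"
    and nz: "\<alpha> k \<noteq> 0"
  shows "\<exists>w. sq_summable w \<and> resolvent_equation z 1 w (\<lambda>_. 0) \<and> w k / of_real (t k) + 1 * \<alpha> k \<noteq> 0"
proof -
  have tz: "of_real (t n) \<noteq> z" for n using z by auto
  have g: "sq_summable (\<lambda>_ :: 'i. 0)" by simp
  let ?w = "solution_part z 1 (\<lambda>_. 0)"
  have "solution_part z 0 (\<lambda>_. 0) = (\<lambda>_. 0)" by (auto simp: solution_part_def)
  then have "(\<Sum>\<^sub>\<infinity>n. ?w n * \<beta> n) = partial_fractions residue_coeffs z"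
    using functional_of_solution_part[OF g, of z 1] tz by simp
  moreover have "?w n - z * (?w n / of_real (t n) + 1 * \<alpha> n) = 0" for n
    using resolvent_equation_componentwise[of ?w n z 1 "\<lambda>_. 0"] tz by simp
  ultimately have "resolvent_equation z 1 ?w (\<lambda>_. 0)"
    unfolding resolvent_equation_def using zero by simp
  moreover have "?w k / of_real (t k) + 1 * \<alpha> k = \<alpha> k * of_real (t k) / (of_real (t k) - z)"
    using tz[of k] by (simp add: solution_part_def field_simps)
  ultimately show ?thesis
    using solution_part_l2[OF g] nz tz[of k] by (intro exI[of _ ?w]) simp
qed

end

section \<open>Factoring the coefficients of a symbol\<close>

context point_spectrum
begin

lemma countable_index: "countable (UNIV :: 'i set)"
proof -
  have "n \<in> (\<Union>N::nat. {n. \<not> real N \<le> \<bar>t n\<bar>})" for n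
    using reals_Archimedean2[of "\<bar>t n\<bar>"] by (auto simp: not_le)
  then have "UNIV = (\<Union>N::nat. {n. \<not> real N \<le> \<bar>t n\<bar>})" by blast
  moreover have "countable (\<Union>N::nat. {n. \<not> real N \<le> \<bar>t n\<bar>})"
    by (intro countable_UN) (simp_all add: countable_finite[OF finite_bounded_part])
  ultimately show ?thesis by simp
qed

text \<open>Choose indices with \<open>|t\<^sub>n|\<close> growing geometrically.\<close>

lemma sparse_index_set:
  obtains J where "infinite J" "(\<lambda>n. 1 / (t n)\<^sup>2) summable_on J"
proof -
  have ex: "\<exists>n. R \<le> \<bar>t n\<bar>" for R
    using finite_bounded_part[of R] infinite_index by (metis (mono_tags) UNIV_eq_I mem_Collect_eq)
  have "\<exists>f. \<forall>k. (2 ^ k \<le> \<bar>t (f k)\<bar>) \<and> \<bar>t (f k)\<bar> < \<bar>t (f (Suc k))\<bar>"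
  proof (rule dependent_nat_choice)
    show "\<exists>n. 2 ^ 0 \<le> \<bar>t n\<bar>" by (rule ex)
    show "\<exists>n'. 2 ^ Suc k \<le> \<bar>t n'\<bar> \<and> \<bar>t n\<bar> < \<bar>t n'\<bar>" for n k
    proof -
      obtain n' where "max (2 ^ Suc k) (\<bar>t n\<bar> + 1) \<le> \<bar>t n'\<bar>" using ex by blast
      then show ?thesis by (intro exI[of _ n']) auto
    qed
  qed
  then obtain f where f: "\<And>k. 2 ^ k \<le> \<bar>t (f k)\<bar>" "\<And>k. \<bar>t (f k)\<bar> < \<bar>t (f (Suc k))\<bar>"
    by blast
  have "strict_mono (\<lambda>k. \<bar>t (f k)\<bar>)" using f(2) by (simp add: strict_mono_Suc_iff)
  then have inj_f: "inj f"
    by (metis (mono_tags, lifting) injI strict_mono_eq)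
  have "(\<lambda>k. 1 / (t (f k))\<^sup>2) summable_on UNIV"
  proof (rule summable_on_comparison_test)
    have "summable (\<lambda>k. norm ((1 / 4 :: real) ^ k))" by (simp add: summable_geometric)
    then show "(\<lambda>k. (1 / 4 :: real) ^ k) summable_on UNIV"
      by (rule norm_summable_imp_summable_on)
    show "1 / (t (f k))\<^sup>2 \<le> (1 / 4) ^ k" for k
    proof -
      have "(2 ^ k)\<^sup>2 \<le> (t (f k))\<^sup>2" using f(1)[of k] by (metis abs_le_square_iff abs_numeral power_abs)
      moreover have "(2 ^ k)\<^sup>2 = (4::real) ^ k"
        by (simp add: power2_eq_square flip: power_mult_distrib)
      ultimately have "4 ^ k \<le> (t (f k))\<^sup>2" by simp
      then show ?thesis by (simp add: power_divide frac_le)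
    qed
  qed auto
  then have "(\<lambda>n. 1 / (t n)\<^sup>2) summable_on range f"
    using inj_f by (subst summable_on_reindex) (auto simp: o_def)
  moreover have "infinite (range f)" using inj_f range_inj_infinite by blast
  ultimately show ?thesis using that by blast
qed

text \<open>The natural choice \<open>|t\<^sub>n \<alpha>\<^sub>n|\<^sup>2 = |d\<^sub>n|\<close> can be square summable, and then \<open>a\<close> belongs to \<open>L\<^sup>2\<close> and \<open>\<kappa>\<close> might be the
  excluded value. Adding \<open>1\<close> to it on a sparse infinite index set destroys the square summability of
  \<open>t\<^sub>n \<alpha>\<^sub>n\<close>, but not that of \<open>\<alpha>\<^sub>n\<close>, and only makes \<open>\<beta>\<^sub>n\<close> smaller.\<close>

lemma factorization_outside_l2:
  assumes adm: "admissible d" and nz: "\<And>n. d n \<noteq> 0"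
  obtains \<alpha> \<beta> :: "'i \<Rightarrow> complex" where "sq_summable \<alpha>" "sq_summable \<beta>" "\<And>n. \<alpha> n \<noteq> 0" "\<And>n. \<beta> n \<noteq> 0"
    "\<And>n. \<alpha> n * \<beta> n * (of_real (t n))\<^sup>2 = d n" "\<not> sq_summable (\<lambda>n. of_real (t n) * \<alpha> n)"
proof -
  obtain J where J: "infinite J" "(\<lambda>n. 1 / (t n)\<^sup>2) summable_on J"
    by (rule sparse_index_set)
  \<comment> \<open>\<open>A n\<close> is the modulus of \<open>t\<^sub>n \<alpha>\<^sub>n\<close>.\<close>
  define A where "A n = sqrt (cmod (d n) + (if n \<in> J then 1 else 0))" for n
  have A2: "(A n)\<^sup>2 = cmod (d n) + (if n \<in> J then 1 else 0)" for n
    by (simp add: A_def)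
  have Apos: "A n > 0" for n using nz[of n] by (simp add: A_def add_pos_nonneg)
  define \<alpha> :: "'i \<Rightarrow> complex" where "\<alpha> n = of_real (A n / t n)" for n
  define \<beta> where "\<beta> n = d n / of_real (A n * t n)" for n
  have d: "(\<lambda>n. cmod (d n) / (t n)\<^sup>2) summable_on UNIV" using adm by (simp add: admissible_def)
  show ?thesis
  proof
    have "(\<lambda>n. if n \<in> J then 1 / (t n)\<^sup>2 else 0) summable_on UNIV"
      using J(2) by (subst (asm) summable_on_cong_neutral[where T = UNIV]) auto
    then have "(\<lambda>n. cmod (d n) / (t n)\<^sup>2 + (if n \<in> J then 1 / (t n)\<^sup>2 else 0)) summable_on UNIV"
      by (intro summable_on_add d)
    moreover have "(cmod (\<alpha> n))\<^sup>2 = cmod (d n) / (t n)\<^sup>2 + (if n \<in> J then 1 / (t n)\<^sup>2 else 0)" for n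
      using A2[of n] by (simp add: \<alpha>_def norm_divide power_divide add_divide_distrib)
    ultimately show "sq_summable \<alpha>" by (simp add: sq_summable_def)
    show "sq_summable \<beta>"
      unfolding sq_summable_def
    proof (rule summable_on_comparison_test[OF d])
      fix n
      have "(cmod (\<beta> n))\<^sup>2 = cmod (d n) * cmod (d n) / ((A n)\<^sup>2 * (t n)\<^sup>2)"
        by (simp add: \<beta>_def norm_divide norm_mult power_divide power_mult_distrib
            power2_eq_square[of "cmod (d n)"])
      also have "\<dots> = cmod (d n) / (A n)\<^sup>2 * (cmod (d n) / (t n)\<^sup>2)" by simp
      also have "\<dots> \<le> 1 * (cmod (d n) / (t n)\<^sup>2)"
      proof (rule mult_right_mono)
        show "cmod (d n) / (A n)\<^sup>2 \<le> 1"
          by (subst divide_le_eq_1_pos) (use Apos[of n] in simp, simp add: A2)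
      qed auto
      finally show "(cmod (\<beta> n))\<^sup>2 \<le> cmod (d n) / (t n)\<^sup>2" by simp
    qed auto
    show "\<alpha> n \<noteq> 0" "\<beta> n \<noteq> 0" for n
      using Apos[of n] nz[of n] by (auto simp: \<alpha>_def \<beta>_def)
    show "\<alpha> n * \<beta> n * (of_real (t n))\<^sup>2 = d n" for n
      using Apos[of n] by (simp add: \<alpha>_def \<beta>_def power2_eq_square)
    show "\<not> sq_summable (\<lambda>n. of_real (t n) * \<alpha> n)"
    proof
      assume "sq_summable (\<lambda>n. of_real (t n) * \<alpha> n)"
      then have "(\<lambda>n. (A n)\<^sup>2) summable_on UNIV"
        using Apos by (simp add: sq_summable_def \<alpha>_def norm_mult norm_divide)
      then have "(\<lambda>n. (A n)\<^sup>2) summable_on J"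
        by (rule summable_on_subset_banach) auto
      then have "(\<lambda>n. 1::real) summable_on J"
        by (rule summable_on_comparison_test) (auto simp: A2)
      then show False using infsum_diverge_constant[OF J(1), of "1::real"] by simp
    qed
  qed
qed

end

section \<open>Coordinates in \<open>L\<^sup>2\<close> of an atomic measure\<close>

locale atomic_spectrum = point_spectrum t for t :: "'i \<Rightarrow> real" +
  fixes m :: "'i \<Rightarrow> real"
  assumes mass: "0 < m n"
begin

abbreviation "M \<equiv> atomic_measure t m"

lemma mass_nonneg [simp]: "0 \<le> m n" and mass_nonzero [simp]: "m n \<noteq> 0"
  using mass[of n] by auto

lemma sets_M [simp, measurable_cong]: "sets M = sets borel"
  by (simp add: atomic_measure_def)

lemma space_M [simp]: "space M = UNIV"
  by (simp add: atomic_measure_def)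

lemma measurable_M [simp]: "borel_measurable M = borel_measurable borel"
  by (rule measurable_cong_sets) auto

text \<open>Every atom has positive mass, and the complement of the countable set of atoms is a null set.\<close>

lemma AE_iff: "(AE x in M. P x) \<longleftrightarrow> (\<forall>n. P (t n))"
proof
  let ?D = "density (count_space UNIV) (\<lambda>n. ennreal (m n))"
  have AE_D: "(AE n in ?D. Q n) \<longleftrightarrow> (\<forall>n. Q n)" for Q
    by (subst AE_density) (auto simp: AE_count_space mass)
  have t: "t \<in> measurable ?D borel" by simp
  show "\<forall>n. P (t n)" if "AE x in M. P x"
    using AE_distrD[OF t, of P] that unfolding AE_D atomic_measure_def by blast
  assume P: "\<forall>n. P (t n)"
  have "countable (range t)" using countable_index by (rule countable_image)
  then have "range t \<in> sets borel" by (rule sets.countable[rotated]) simp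
  then have "{x \<in> space borel. x \<in> range t} \<in> sets borel" by simp
  then have "(AE x in M. x \<in> range t) \<longleftrightarrow> (AE n in ?D. t n \<in> range t)"
    unfolding atomic_measure_def by (rule AE_distr_iff[OF t])
  then have "AE x in M. x \<in> range t" by simp
  then show "AE x in M. P x"
  proof eventually_elim
    case (elim x)
    then show ?case using P by blast
  qed
qed

text \<open>Coordinates with respect to the orthonormal basis of normalized point masses.\<close>

definition coeffs :: "(real \<Rightarrow> complex) \<Rightarrow> 'i \<Rightarrow> complex" where
  "coeffs f n = of_real (sqrt (m n)) * f (t n)"

lemma coeffs_eq_iff: "coeffs f n = coeffs g n \<longleftrightarrow> f (t n) = g (t n)"
  by (simp add: coeffs_def)

lemma coeffs_diff_scale: "coeffs (\<lambda>x. f x - z * g x) n = coeffs f n - z * coeffs g n"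
  by (simp add: coeffs_def algebra_simps)

lemma norm_coeffs: "(cmod (coeffs f n))\<^sup>2 = m n * (cmod (f (t n)))\<^sup>2"
  by (simp add: coeffs_def norm_mult power_mult_distrib)

lemma coeffs_mult: "coeffs f n * cnj (coeffs g n) = m n *\<^sub>R (f (t n) * cnj (g (t n)))"
proof -
  have "complex_of_real (sqrt (m n)) * of_real (sqrt (m n)) = of_real (m n)"
    by (simp flip: of_real_mult)
  then show ?thesis
    by (simp add: coeffs_def scaleR_conv_of_real)
qed

lemma
  fixes f :: "real \<Rightarrow> 'b :: {banach, second_countable_topology}"
  assumes "f \<in> borel_measurable borel"
  shows integrable_M_iff: "integrable M f \<longleftrightarrow> (\<lambda>n. norm (m n *\<^sub>R f (t n))) summable_on UNIV"
    and integral_M: "(\<lambda>n. norm (m n *\<^sub>R f (t n))) summable_on UNIV \<Longrightarrow>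
      integral\<^sup>L M f = (\<Sum>\<^sub>\<infinity>n. m n *\<^sub>R f (t n))"
proof -
  let ?D = "density (count_space UNIV) (\<lambda>n. ennreal (m n))"
  have t: "t \<in> measurable ?D borel" by simp
  have "integrable M f \<longleftrightarrow> integrable (count_space UNIV) (\<lambda>n. m n *\<^sub>R f (t n))"
    unfolding atomic_measure_def
    by (subst integrable_distr_eq[OF t assms], subst integrable_density) auto
  also have "\<dots> \<longleftrightarrow> (\<lambda>n. norm (m n *\<^sub>R f (t n))) summable_on UNIV"
    by (simp only: abs_summable_equivalent abs_summable_on_def)
  finally show "integrable M f \<longleftrightarrow> (\<lambda>n. norm (m n *\<^sub>R f (t n))) summable_on UNIV" .
  assume s: "(\<lambda>n. norm (m n *\<^sub>R f (t n))) summable_on UNIV"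
  have "integral\<^sup>L M f = (\<integral>n. m n *\<^sub>R f (t n) \<partial>count_space UNIV)"
    unfolding atomic_measure_def
    by (subst integral_distr[OF t assms], subst integral_density) auto
  also have "\<dots> = (\<Sum>\<^sub>\<infinity>n. m n *\<^sub>R f (t n))"
    by (rule infsetsum_infsum[OF abs_summable_equivalent[THEN iffD1, OF s], unfolded infsetsum_def])
  finally show "integral\<^sup>L M f = (\<Sum>\<^sub>\<infinity>n. m n *\<^sub>R f (t n))" .
qed

lemma L2_iff: "f \<in> L2 M \<longleftrightarrow> f \<in> borel_measurable borel \<and> sq_summable (coeffs f)"
proof -
  have "integrable M (\<lambda>x. (cmod (f x))\<^sup>2) \<longleftrightarrow> sq_summable (coeffs f)" if "f \<in> borel_measurable borel"
    using that by (subst integrable_M_iff) (auto simp: sq_summable_def norm_coeffs)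
  then show ?thesis by (auto simp: L2_def)
qed

lemma L2_norm_eq:
  assumes "f \<in> L2 M"
  shows "L2_norm M f = l2_norm (coeffs f)"
proof -
  have "(\<integral>x. (cmod (f x))\<^sup>2 \<partial>M) = (\<Sum>\<^sub>\<infinity>n. m n *\<^sub>R (cmod (f (t n)))\<^sup>2)"
    using assms by (intro integral_M) (auto simp: L2_iff sq_summable_def norm_coeffs)
  then show ?thesis by (simp add: L2_norm_def l2_norm_def norm_coeffs)
qed

lemma L2_pair_eq:
  assumes "f \<in> borel_measurable borel" "g \<in> borel_measurable borel"
    and "(\<lambda>n. cmod (coeffs f n * cnj (coeffs g n))) summable_on UNIV"
  shows "L2_pair M f g = (\<Sum>\<^sub>\<infinity>n. coeffs f n * cnj (coeffs g n))"
  unfolding L2_pair_def coeffs_mult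
proof (rule integral_M)
  have "(\<lambda>x. cnj (g x)) \<in> borel_measurable borel"
    by (rule measurable_compose[OF assms(2)])
      (intro borel_measurable_continuous_onI continuous_intros)
  then show "(\<lambda>x. f x * cnj (g x)) \<in> borel_measurable borel"
    by (intro borel_measurable_times assms)
qed (use assms(3) in \<open>simp add: coeffs_mult\<close>)

definition fun_of_coeffs :: "('i \<Rightarrow> complex) \<Rightarrow> real \<Rightarrow> complex" where
  "fun_of_coeffs u x = (if x \<in> range t then u (inv t x) / of_real (sqrt (m (inv t x))) else 0)"

lemma coeffs_fun_of_coeffs [simp]: "coeffs (fun_of_coeffs u) = u"
  using inj by (auto simp: coeffs_def fun_of_coeffs_def)

lemma fun_of_coeffs_measurable: "fun_of_coeffs u \<in> borel_measurable borel"
proof (rule measurable_discrete_difference[where f = "\<lambda>_. 0" and X = "range t"])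
  show "countable (range t)" using countable_index by simp
qed (auto simp: fun_of_coeffs_def)

lemma fun_of_coeffs_L2: "sq_summable u \<Longrightarrow> fun_of_coeffs u \<in> L2 M"
  by (simp add: L2_iff fun_of_coeffs_measurable)

lemma coeffs_div_x: "coeffs (div_x f) n = coeffs f n / of_real (t n)"
  by (simp add: coeffs_def div_x_def)

lemma inverse_bounded: "\<exists>K\<ge>0. \<forall>n. 1 / \<bar>t n\<bar> \<le> K"
proof -
  obtain K where K: "K > 0"
    "\<forall>n. of_real (t n) \<noteq> (0::complex) \<longrightarrow> \<bar>t n\<bar> + 1 \<le> K * cmod (of_real (t n) - 0)"
    using ratio_bounded by blast
  have "1 / \<bar>t n\<bar> \<le> K" for n
  proof -
    have "\<bar>t n\<bar> + 1 \<le> K * \<bar>t n\<bar>" using K(2) by simp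
    then have "1 \<le> K * \<bar>t n\<bar>" using abs_ge_zero[of "t n"] by linarith
    then show ?thesis by (simp add: divide_le_eq)
  qed
  with K(1) show ?thesis by (intro exI[of _ K]) auto
qed

lemma sq_summable_div_t:
  assumes "sq_summable u"
  shows "sq_summable (\<lambda>n. u n / of_real (t n))"
proof -
  obtain K where K: "K \<ge> 0" "\<forall>n. 1 / \<bar>t n\<bar> \<le> K" using inverse_bounded by blast
  show ?thesis
  proof (rule l2_dominated(1)[OF assms K(1)])
    show "cmod (u n / of_real (t n)) \<le> K * cmod (u n)" for n
      using mult_right_mono[OF spec[OF K(2), of n], of "cmod (u n)"] by (simp add: norm_divide)
  qed
qed


section \<open>Spectra of rank one perturbations\<close>

context
  fixes a b :: "real \<Rightarrow> complex" and \<kappa> :: complex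
  assumes a: "div_x a \<in> L2 M" and b: "div_x b \<in> L2 M"
begin

interpretation model: rank_one_sequence_model t "coeffs (div_x a)" "\<lambda>n. cnj (coeffs (div_x b) n)" \<kappa>
  by unfold_locales (use a b in \<open>auto simp: L2_iff sq_summable_def\<close>)

lemma b_measurable: "b \<in> borel_measurable borel"
proof (rule measurable_discrete_difference[where f = "\<lambda>x. of_real x * div_x b x" and X = "{0}"])
  show "(\<lambda>x. of_real x * div_x b x) \<in> borel_measurable borel"
    using b by (intro borel_measurable_times) (auto simp: L2_iff)
qed (auto simp: div_x_def)

text \<open>Since \<open>y\<^sub>0 = w / x\<close> up to a null set, the existential quantifier over \<open>y\<^sub>0\<close> disappears, and its pairing
  with \<open>b\<close> is that of \<open>w\<close> with \<open>b / x\<close>. This pairing converges by Cauchy-Schwarz even if \<open>b\<close> is not in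
  \<open>L\<^sup>2\<close>.\<close>

lemma rank_one_perturbation_iff:
  "(y, w) \<in> rank_one_perturbation M a b \<kappa> \<longleftrightarrow> y \<in> L2 M \<and> w \<in> L2 M \<and>
     (\<exists>c. \<kappa> * c + (\<Sum>\<^sub>\<infinity>n. coeffs w n * cnj (coeffs (div_x b) n)) = 0 \<and>
        (\<forall>n. coeffs y n = coeffs w n / of_real (t n) + c * coeffs (div_x a) n))"
  (is "?L \<longleftrightarrow> ?R")
proof -
  have pair: "L2_pair M y0 b = (\<Sum>\<^sub>\<infinity>n. coeffs w n * cnj (coeffs (div_x b) n))"
    if y0: "y0 \<in> borel_measurable borel" and w: "w \<in> L2 M" "\<And>n. w (t n) = of_real (t n) * y0 (t n)"
    for y0 w
  proof -
    have "coeffs y0 n * cnj (coeffs b n) = coeffs w n * cnj (coeffs (div_x b) n)" for n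
      by (simp add: coeffs_div_x) (simp add: coeffs_def w(2))
    moreover have "(\<lambda>n. cmod (coeffs w n * cnj (coeffs (div_x b) n))) summable_on UNIV"
      using w(1) model.\<beta> by (intro l2_Cauchy_Schwarz) (auto simp: L2_iff)
    ultimately show ?thesis
      using L2_pair_eq[OF y0 b_measurable] by simp
  qed
  show ?thesis
  proof
    assume ?L
    then obtain c y0 where *: "y \<in> L2 M" "w \<in> L2 M" "y0 \<in> mult_domain M" "\<kappa> * c + L2_pair M y0 b = 0"
      "\<And>n. y (t n) = y0 (t n) + c * div_x a (t n)" "\<And>n. w (t n) = of_real (t n) * y0 (t n)"
      unfolding rank_one_perturbation_def AE_iff by blast
    have "y0 \<in> borel_measurable borel" using *(3) by (simp add: mult_domain_def L2_iff)
    from pair[OF this *(2,6)] *(4)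
    have "\<kappa> * c + (\<Sum>\<^sub>\<infinity>n. coeffs w n * cnj (coeffs (div_x b) n)) = 0" by simp
    moreover have "coeffs y n = coeffs w n / of_real (t n) + c * coeffs (div_x a) n" for n
      by (simp add: coeffs_def *(5,6) algebra_simps)
    ultimately show ?R using * by blast
  next
    assume ?R
    then obtain c where *: "y \<in> L2 M" "w \<in> L2 M"
      "\<kappa> * c + (\<Sum>\<^sub>\<infinity>n. coeffs w n * cnj (coeffs (div_x b) n)) = 0"
      "\<And>n. coeffs y n = coeffs w n / of_real (t n) + c * coeffs (div_x a) n" by blast
    let ?y0 = "div_x w"
    have w_meas: "w \<in> borel_measurable borel" and w_l2: "sq_summable (coeffs w)"
      using *(2) by (auto simp: L2_iff)
    have y0: "?y0 \<in> borel_measurable borel"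
      unfolding div_x_def using w_meas by measurable
    have xy0: "(\<lambda>x. of_real x * ?y0 x) \<in> borel_measurable borel"
      using y0 by (intro borel_measurable_times) auto
    have "coeffs (\<lambda>x. of_real x * ?y0 x) = coeffs w"
      by (simp add: fun_eq_iff coeffs_def div_x_def)
    moreover have "sq_summable (coeffs ?y0)"
      using sq_summable_div_t[OF w_l2] by (simp add: coeffs_div_x[abs_def])
    ultimately have "?y0 \<in> mult_domain M"
      using y0 xy0 w_l2 by (simp add: mult_domain_def L2_iff)
    moreover have "w (t n) = of_real (t n) * ?y0 (t n)" for n by (simp add: div_x_def)
    moreover have "y (t n) = ?y0 (t n) + c * div_x a (t n)" for n
    proof -
      have "of_real (sqrt (m n)) * y (t n) = of_real (sqrt (m n)) * (?y0 (t n) + c * div_x a (t n))"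
        using *(4)[of n] by (simp add: coeffs_def div_x_def algebra_simps)
      then show ?thesis by simp
    qed
    moreover have "\<kappa> * c + L2_pair M ?y0 b = 0"
      using pair[OF y0 *(2)] calculation(2) *(3) by simp
    ultimately show ?L
      unfolding rank_one_perturbation_def AE_iff using *(1,2) by blast
  qed
qed

lemma rank_one_perturbation_cases:
  assumes "(y, w) \<in> rank_one_perturbation M a b \<kappa>"
  obtains c where "sq_summable (coeffs w)"
    "\<And>n. coeffs y n = coeffs w n / of_real (t n) + c * coeffs (div_x a) n"
    "\<And>z. model.resolvent_equation z c (coeffs w) (coeffs (\<lambda>x. w x - z * y x))"
proof -
  from assms obtain c where *: "w \<in> L2 M"
    "\<kappa> * c + (\<Sum>\<^sub>\<infinity>n. coeffs w n * cnj (coeffs (div_x b) n)) = 0"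
    "\<And>n. coeffs y n = coeffs w n / of_real (t n) + c * coeffs (div_x a) n"
    unfolding rank_one_perturbation_iff by blast
  have "coeffs w n - z * (coeffs w n / of_real (t n) + c * coeffs (div_x a) n)
      = coeffs (\<lambda>x. w x - z * y x) n" for n z
    unfolding *(3)[symmetric] coeffs_diff_scale ..
  with * show ?thesis
    by (intro that) (auto simp: model.resolvent_equation_def L2_iff)
qed

lemma rank_one_perturbationI:
  assumes w: "sq_summable w" and eq: "model.resolvent_equation z c w g"
  obtains y v where "(y, v) \<in> rank_one_perturbation M a b \<kappa>"
    "\<And>n. coeffs y n = w n / of_real (t n) + c * coeffs (div_x a) n"
    "\<And>n. coeffs (\<lambda>x. v x - z * y x) n = g n"
proof
  let ?u = "\<lambda>n. w n / of_real (t n) + c * coeffs (div_x a) n"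
  let ?y = "fun_of_coeffs ?u" and ?v = "fun_of_coeffs w"
  have u: "sq_summable ?u"
    by (intro l2_add sq_summable_div_t w l2_scale model.\<alpha>)
  show "(?y, ?v) \<in> rank_one_perturbation M a b \<kappa>"
    unfolding rank_one_perturbation_iff using eq
    by (auto simp: fun_of_coeffs_L2 u w model.resolvent_equation_def)
  show "coeffs ?y n = ?u n" for n by simp
  show "coeffs (\<lambda>x. ?v x - z * ?y x) n = g n" for n
    using eq by (simp add: model.resolvent_equation_def coeffs_diff_scale)
qed

text \<open>Injectivity is a consequence of the bound, applied to the difference of two solutions.\<close>

lemma in_resolvent_setI:
  assumes bound: "\<exists>C. \<forall>w g c. sq_summable g \<longrightarrow> model.resolvent_equation z c w g \<longrightarrow>
           l2_norm (\<lambda>n. w n / of_real (t n) + c * coeffs (div_x a) n) \<le> C * l2_norm g"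
    and solvable: "\<And>g. sq_summable g \<Longrightarrow> \<exists>w c. sq_summable w \<and> model.resolvent_equation z c w g"
  shows "z \<in> resolvent_set M (rank_one_perturbation M a b \<kappa>)"
proof -
  let ?T = "rank_one_perturbation M a b \<kappa>"
  obtain C where C: "\<And>w g c. sq_summable g \<Longrightarrow> model.resolvent_equation z c w g \<Longrightarrow>
           l2_norm (\<lambda>n. w n / of_real (t n) + c * coeffs (div_x a) n) \<le> C * l2_norm g"
    using bound by blast
  have inj: "AE x in M. y x = y' x"
    if T: "(y, w) \<in> ?T" "(y', w') \<in> ?T" and eq: "AE x in M. w x - z * y x = w' x - z * y' x"
    for y w y' w'
  proof -
    obtain c where c: "sq_summable (coeffs w)"
      "\<And>n. coeffs y n = coeffs w n / of_real (t n) + c * coeffs (div_x a) n"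
      "model.resolvent_equation z c (coeffs w) (coeffs (\<lambda>x. w x - z * y x))"
      by (rule rank_one_perturbation_cases[OF T(1)]) (rule that)
    obtain c' where c': "sq_summable (coeffs w')"
      "\<And>n. coeffs y' n = coeffs w' n / of_real (t n) + c' * coeffs (div_x a) n"
      "model.resolvent_equation z c' (coeffs w') (coeffs (\<lambda>x. w' x - z * y' x))"
      by (rule rank_one_perturbation_cases[OF T(2)]) (rule that)
    have same: "coeffs (\<lambda>x. w x - z * y x) n = coeffs (\<lambda>x. w' x - z * y' x) n" for n
      using eq unfolding AE_iff coeffs_eq_iff by blast
    let ?\<delta> = "\<lambda>n. coeffs w n - coeffs w' n"
    have d: "sq_summable ?\<delta>"
      using l2_add(1)[OF c(1) l2_scale[OF c'(1), of "-1"]] by simp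
    have "model.resolvent_equation z (c - c') ?\<delta> (\<lambda>_. 0)"
      unfolding model.resolvent_equation_def
    proof
      let ?S = "\<lambda>w. \<Sum>\<^sub>\<infinity>n. coeffs w n * cnj (coeffs (div_x b) n)"
      have "((\<lambda>n. ?\<delta> n * cnj (coeffs (div_x b) n)) has_sum (?S w - ?S w')) UNIV"
        using has_sum_add[OF has_sum_infsum[OF l2_product_summable[OF c(1) model.\<beta>]]
            has_sum_uminusI[OF has_sum_infsum[OF l2_product_summable[OF c'(1) model.\<beta>]]]]
        by (simp add: left_diff_distrib)
      then have "\<kappa> * (c - c') + (\<Sum>\<^sub>\<infinity>n. ?\<delta> n * cnj (coeffs (div_x b) n))
          = (\<kappa> * c + ?S w) - (\<kappa> * c' + ?S w')"
        by (simp add: infsumI right_diff_distrib)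
      also have "\<dots> = 0"
        using c(3) c'(3) unfolding model.resolvent_equation_def by simp
      finally show "\<kappa> * (c - c') + (\<Sum>\<^sub>\<infinity>n. ?\<delta> n * cnj (coeffs (div_x b) n)) = 0" .
      show "\<forall>n. ?\<delta> n - z * (?\<delta> n / of_real (t n) + (c - c') * coeffs (div_x a) n) = 0"
      proof
        fix n
        have "coeffs w n - z * (coeffs w n / of_real (t n) + c * coeffs (div_x a) n)
            = coeffs w' n - z * (coeffs w' n / of_real (t n) + c' * coeffs (div_x a) n)"
          using c(3) c'(3) same[of n] unfolding model.resolvent_equation_def by metis
        then show "?\<delta> n - z * (?\<delta> n / of_real (t n) + (c - c') * coeffs (div_x a) n) = 0"
          by (simp add: algebra_simps diff_divide_distrib)
      qed
    qed
    from C[OF _ this] have le: "l2_norm (\<lambda>n. ?\<delta> n / of_real (t n) + (c - c') * coeffs (div_x a) n) \<le> 0"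
      by simp
    have "?\<delta> n / of_real (t n) + (c - c') * coeffs (div_x a) n = 0" for n
      using order_trans[OF component_le_l2_norm le, of n]
        l2_add(1)[OF sq_summable_div_t[OF d] l2_scale[OF model.\<alpha>]] by simp
    then have "coeffs y n = coeffs y' n" for n
      by (simp add: c(2) c'(2) algebra_simps diff_divide_distrib)
    then show ?thesis unfolding AE_iff coeffs_eq_iff by blast
  qed
  have surj: "\<exists>(y, w)\<in>?T. AE x in M. w x - z * y x = g x" if g: "g \<in> L2 M" for g
  proof -
    obtain w c where wc: "sq_summable w" "model.resolvent_equation z c w (coeffs g)"
      using solvable[of "coeffs g"] g by (auto simp: L2_iff)
    obtain y v where "(y, v) \<in> ?T" "\<And>n. coeffs (\<lambda>x. v x - z * y x) n = coeffs g n"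
      by (rule rank_one_perturbationI[OF wc]) (rule that)
    then show ?thesis unfolding AE_iff coeffs_eq_iff by blast
  qed
  have bounded: "L2_norm M y \<le> C * L2_norm M (\<lambda>x. w x - z * y x)" if T: "(y, w) \<in> ?T" for y w
  proof -
    obtain c where c: "sq_summable (coeffs w)"
      "\<And>n. coeffs y n = coeffs w n / of_real (t n) + c * coeffs (div_x a) n"
      "model.resolvent_equation z c (coeffs w) (coeffs (\<lambda>x. w x - z * y x))"
      by (rule rank_one_perturbation_cases[OF T]) (rule that)
    have y: "y \<in> L2 M" and w: "w \<in> L2 M" using T unfolding rank_one_perturbation_iff by auto
    have "coeffs (\<lambda>x. w x - z * y x) = (\<lambda>n. coeffs w n + (- z) * coeffs y n)"
      by (simp add: fun_eq_iff coeffs_diff_scale)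
    then have s: "sq_summable (coeffs (\<lambda>x. w x - z * y x))"
      using y w by (simp only: L2_iff) (intro l2_add l2_scale; simp)
    then have "(\<lambda>x. w x - z * y x) \<in> L2 M"
      using y w by (auto simp: L2_iff intro!: borel_measurable_diff borel_measurable_times)
    moreover have "l2_norm (coeffs y) \<le> C * l2_norm (coeffs (\<lambda>x. w x - z * y x))"
    proof -
      have "coeffs y = (\<lambda>n. coeffs w n / of_real (t n) + c * coeffs (div_x a) n)"
        using c(2) by auto
      then show ?thesis using C[OF s c(3)] by (simp only:)
    qed
    ultimately show ?thesis using y by (simp add: L2_norm_eq)
  qed
  show ?thesis
    unfolding resolvent_set_def using inj surj bounded by blast
qed

lemma resolvent_set_injective:
  assumes z: "z \<in> resolvent_set M (rank_one_perturbation M a b \<kappa>)"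
    and w: "sq_summable w" and eq: "model.resolvent_equation z c w (\<lambda>_. 0)"
  shows "w n / of_real (t n) + c * coeffs (div_x a) n = 0"
proof -
  let ?T = "rank_one_perturbation M a b \<kappa>"
  obtain y v where yv: "(y, v) \<in> ?T" "\<And>n. coeffs y n = w n / of_real (t n) + c * coeffs (div_x a) n"
    "\<And>n. coeffs (\<lambda>x. v x - z * y x) n = 0"
    by (rule rank_one_perturbationI[OF w eq]) (rule that)
  have "model.resolvent_equation z 0 (\<lambda>_. 0) (\<lambda>_. 0)"
    by (simp add: model.resolvent_equation_def)
  then obtain y' v' where yv': "(y', v') \<in> ?T" "\<And>n. coeffs y' n = 0"
    "\<And>n. coeffs (\<lambda>x. v' x - z * y' x) n = 0"
    by (rule rank_one_perturbationI[OF l2_zero(1)]) (simp add: that)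
  have "coeffs (\<lambda>x. v x - z * y x) n = coeffs (\<lambda>x. v' x - z * y' x) n" for n
    using yv(3) yv'(3) by simp
  then have "AE x in M. v x - z * y x = v' x - z * y' x"
    unfolding AE_iff coeffs_eq_iff by blast
  then have "AE x in M. y x = y' x"
    using z yv(1) yv'(1) unfolding resolvent_set_def by blast
  then have "coeffs y n = coeffs y' n" unfolding AE_iff coeffs_eq_iff by blast
  then show ?thesis by (simp add: yv(2) yv'(2))
qed

text \<open>If \<open>a\<close> vanishes at \<open>t\<^sub>k\<close>, then the range of \<open>L - t\<^sub>k\<close> misses the point mass at \<open>t\<^sub>k\<close>; if \<open>b\<close> vanishes at \<open>t\<^sub>k\<close>,
  then this point mass is an eigenvector; and a zero of the symbol is an eigenvalue. Otherwise the
  resolvent equation has been solved with a bound for every \<open>z\<close>.\<close>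

theorem spectrum_empty_iff:
  "op_spectrum M (rank_one_perturbation M a b \<kappa>) = {} \<longleftrightarrow>
     (\<forall>n. coeffs (div_x a) n \<noteq> 0 \<and> coeffs (div_x b) n \<noteq> 0) \<and>
     (\<forall>z. z \<notin> of_real ` range t \<longrightarrow> \<kappa> + partial_fractions model.residue_coeffs z \<noteq> 0)"
  (is "?L \<longleftrightarrow> ?R1 \<and> ?R2")
proof
  let ?T = "rank_one_perturbation M a b \<kappa>"
  assume ?L
  then have res: "z \<in> resolvent_set M ?T" for z by (auto simp: op_spectrum_def)
  have single: "sq_summable (\<lambda>n. if n = k then 1 else 0)" for k :: 'i
    by (rule l2_single[of k]) auto
  have a_nz: "coeffs (div_x a) k \<noteq> 0" for k
  proof
    assume ak: "coeffs (div_x a) k = 0"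
    \<comment> \<open>A right-hand side supported at \<open>t\<^sub>k\<close>: the \<open>k\<close>-th component of \<open>(L - t\<^sub>k) y\<close> is a multiple of \<open>\<alpha>\<^sub>k = 0\<close>.\<close>
    let ?g = "fun_of_coeffs (\<lambda>n. if n = k then 1 else 0)"
    obtain y w where T: "(y, w) \<in> ?T" and g: "AE x in M. w x - of_real (t k) * y x = ?g x"
      using res[of "of_real (t k)"] fun_of_coeffs_L2[OF single[of k]] unfolding resolvent_set_def by blast
    obtain c where "model.resolvent_equation (of_real (t k)) c (coeffs w) (coeffs (\<lambda>x. w x - of_real (t k) * y x))"
      by (rule rank_one_perturbation_cases[OF T]) (rule that)
    then have "coeffs w k - of_real (t k) * (coeffs w k / of_real (t k) + c * coeffs (div_x a) k)
        = coeffs (\<lambda>x. w x - of_real (t k) * y x) k"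
      by (simp add: model.resolvent_equation_def)
    also have "\<dots> = coeffs ?g k"
      using g unfolding AE_iff coeffs_eq_iff by blast
    finally show False by (simp add: ak)
  qed
  moreover have "coeffs (div_x b) k \<noteq> 0" for k
  proof
    assume bk: "coeffs (div_x b) k = 0"
    let ?w = "\<lambda>n. if n = k then 1 else 0 :: complex"
    have "(\<Sum>\<^sub>\<infinity>n. ?w n * cnj (coeffs (div_x b) n)) = 0"
      by (intro infsum_0) (auto simp: bk)
    then have "model.resolvent_equation (of_real (t k)) 0 ?w (\<lambda>_. 0)"
      by (auto simp: model.resolvent_equation_def)
    from resolvent_set_injective[OF res single this, of k] show False by simp
  qed
  ultimately have ?R1 by blast
  moreover have ?R2
  proof (intro allI impI notI)
    fix z assume "z \<notin> of_real ` range t" "\<kappa> + partial_fractions model.residue_coeffs z = 0"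
    from model.zero_symbol_gives_eigenvector[OF this a_nz[of undefined]]
    show False using resolvent_set_injective[OF res] by blast
  qed
  ultimately show "?R1 \<and> ?R2" ..
next
  let ?T = "rank_one_perturbation M a b \<kappa>"
  assume R: "?R1 \<and> ?R2"
  have "z \<in> resolvent_set M ?T" for z
  proof (cases "z \<in> of_real ` range t")
    case True
    then obtain k where "z = of_real (t k)" by blast
    then show ?thesis
      using R by (intro in_resolvent_setI model.resolvent_on_spectrum[of z k]) auto
  next
    case False
    then show ?thesis
      using R by (intro in_resolvent_setI model.resolvent_off_spectrum) auto
  qed
  then show ?L by (auto simp: op_spectrum_def)
qed

lemma residue_coeffs_eq:
  "model.residue_coeffs = (\<lambda>n. coeffs (div_x a) n * cnj (coeffs (div_x b) n) * (of_real (t n))\<^sup>2)"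
  by (auto simp: model.residue_coeffs_def)

lemma admissible_residue_coeffs:
  "admissible (\<lambda>n. coeffs (div_x a) n * cnj (coeffs (div_x b) n) * (of_real (t n))\<^sup>2)"
  using model.admissible_residue_coeffs unfolding residue_coeffs_eq .

lemmas spectrum_empty_iff_coeffs = spectrum_empty_iff[unfolded residue_coeffs_eq]

end

theorem removable_iff_zero_free_symbol:
  "removable_spectrum t m \<longleftrightarrow>
    (\<exists>d \<kappa>. admissible d \<and> (\<forall>n. d n \<noteq> 0) \<and>
       (\<forall>z. z \<notin> of_real ` range t \<longrightarrow> \<kappa> + partial_fractions d z \<noteq> 0))"
  (is "?L \<longleftrightarrow> ?R")
proof
  assume ?L
  then obtain a b \<kappa> where ab: "div_x a \<in> L2 M" "div_x b \<in> L2 M"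
    and sp: "op_spectrum M (rank_one_perturbation M a b \<kappa>) = {}"
    unfolding removable_spectrum_def perturbation_data_def by blast
  from sp show ?R
    unfolding spectrum_empty_iff_coeffs[OF ab] using admissible_residue_coeffs[OF ab]
    by (intro exI[of _ "\<lambda>n. coeffs (div_x a) n * cnj (coeffs (div_x b) n) * (of_real (t n))\<^sup>2"]
        exI[of _ \<kappa>]) auto
next
  assume ?R
  then obtain d \<kappa> where d: "admissible d" "\<And>n. d n \<noteq> 0"
    and nz: "\<And>z. z \<notin> of_real ` range t \<Longrightarrow> \<kappa> + partial_fractions d z \<noteq> 0" by blast
  obtain \<alpha> \<beta> where \<alpha>\<beta>: "sq_summable \<alpha>" "sq_summable \<beta>" "\<And>n. \<alpha> n \<noteq> 0" "\<And>n. \<beta> n \<noteq> 0"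
    "\<And>n. \<alpha> n * \<beta> n * (of_real (t n))\<^sup>2 = d n" "\<not> sq_summable (\<lambda>n. of_real (t n) * \<alpha> n)"
    using factorization_outside_l2[OF d] by blast
  define a where "a x = of_real x * fun_of_coeffs \<alpha> x" for x
  define b where "b x = of_real x * fun_of_coeffs (\<lambda>n. cnj (\<beta> n)) x" for x
  have z0: "0 \<notin> range t" by (auto simp: image_iff)
  have div: "div_x a = fun_of_coeffs \<alpha>" "div_x b = fun_of_coeffs (\<lambda>n. cnj (\<beta> n))"
    using z0 by (auto simp: fun_eq_iff div_x_def a_def b_def fun_of_coeffs_def)
  have L2: "div_x a \<in> L2 M" "div_x b \<in> L2 M"
    unfolding div using \<alpha>\<beta>(1,2) by (auto intro!: fun_of_coeffs_L2 simp: sq_summable_def)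
  have "coeffs a n = of_real (t n) * coeffs (fun_of_coeffs \<alpha>) n" for n
    unfolding coeffs_def a_def by simp
  then have "coeffs a = (\<lambda>n. of_real (t n) * \<alpha> n)" by (simp add: fun_eq_iff)
  then have "a \<notin> L2 M"
    using \<alpha>\<beta>(6) by (simp add: L2_iff)
  then have "perturbation_data M a b \<kappa>"
    using L2 by (simp add: perturbation_data_def)
  moreover have "op_spectrum M (rank_one_perturbation M a b \<kappa>) = {}"
    unfolding spectrum_empty_iff_coeffs[OF L2] unfolding div using \<alpha>\<beta>(3,4,5) nz by simp
  ultimately show ?L unfolding removable_spectrum_def by blast
qed

end

theorem theorem1p1:
  fixes t m :: "'i \<Rightarrow> real"
  assumes "infinite (UNIV :: 'i set)"
    and "inj t"
    and "\<And>n. t n \<noteq> 0"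
    and "filterlim (\<lambda>n. \<bar>t n\<bar>) at_top cofinite"
    and "\<And>n. m n > 0"
  shows "removable_spectrum t m \<longleftrightarrow>
    (\<exists>F \<in> Krein_class_1. {z. F z = 0} = of_real ` range t)"
proof -
  interpret atomic_spectrum t m
    by unfold_locales (use assms in auto)
  show ?thesis
    unfolding removable_iff_zero_free_symbol Krein_class_iff_zero_free_symbol ..
qed

end
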